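(* Let $\xi$ be a bi-infinite word. (a) If $\xi$ is periodic, then the type of $\xi$ is finite and its cardinality equals the period of $\xi$. (b) If $\xi$ is non-recurrent, then the type of $\xi$ has cardinality $\aleph_0$. (c) If $\xi$ is recurrent and non-periodic, then the type of $\xi$ has cardinality $2^{\aleph_0}$.
   Context: A bi-infinite word is a map $\xi\colon\mathbb Z\to\{0,1\}$, viewed as the structure $(\mathbb Z,\le,\xi^{-1}(1))$. Two bi-infinite words are MSO-equivalent if they satisfy the same monadic second-order sentences over $\{\le,P\}$; the type of $\xi$ is its MSO-equivalence class (a set of bi-infinite words). $\xi$ is periodic if there is $p>0$ with $\xi(n)=\xi(n+p)$ for all $n\in\mathbb Z$, and its period is the least such $p$. $F(\xi)$ is the set of factors $\xi(i)\cdots\xi(j)$ ($i\le j$) plus the empty word; $\xi$ is recurrent if $F(\xi)=F(\xi(-\infty,i])=F(\xi[i,\infty))$ for all $i\in\mathbb Z$, where the factor sets of the left- and right-infinite halves are defined analogously. *)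

theory Defs
  imports Main "HOL-Library.Equipollence"
begin

text \<open>First-order and set variables are two separate families, each indexed by \<open>nat\<close>.\<close>

datatype mso =
    Le nat nat          \<comment> \<open>\<open>x \<le> y\<close>\<close>
  | Eq nat nat          \<comment> \<open>\<open>x = y\<close>\<close>
  | Pr nat              \<comment> \<open>\<open>P(x)\<close>\<close>
  | Mem nat nat         \<comment> \<open>\<open>x \<in> X\<close>\<close>
  | Neg mso
  | Conj mso mso
  | Disj mso mso
  | Ex1 nat mso
  | All1 nat mso
  | Ex2 nat mso
  | All2 nat mso

primrec free1 :: "mso \<Rightarrow> nat set" where
  "free1 (Le x y) = {x, y}"
| "free1 (Eq x y) = {x, y}"
| "free1 (Pr x) = {x}"
| "free1 (Mem x X) = {x}"
| "free1 (Neg \<phi>) = free1 \<phi>"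
| "free1 (Conj \<phi> \<psi>) = free1 \<phi> \<union> free1 \<psi>"
| "free1 (Disj \<phi> \<psi>) = free1 \<phi> \<union> free1 \<psi>"
| "free1 (Ex1 x \<phi>) = free1 \<phi> - {x}"
| "free1 (All1 x \<phi>) = free1 \<phi> - {x}"
| "free1 (Ex2 X \<phi>) = free1 \<phi>"
| "free1 (All2 X \<phi>) = free1 \<phi>"

primrec free2 :: "mso \<Rightarrow> nat set" where
  "free2 (Le x y) = {}"
| "free2 (Eq x y) = {}"
| "free2 (Pr x) = {}"
| "free2 (Mem x X) = {X}"
| "free2 (Neg \<phi>) = free2 \<phi>"
| "free2 (Conj \<phi> \<psi>) = free2 \<phi> \<union> free2 \<psi>"
| "free2 (Disj \<phi> \<psi>) = free2 \<phi> \<union> free2 \<psi>"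
| "free2 (Ex1 x \<phi>) = free2 \<phi>"
| "free2 (All1 x \<phi>) = free2 \<phi>"
| "free2 (Ex2 X \<phi>) = free2 \<phi> - {X}"
| "free2 (All2 X \<phi>) = free2 \<phi> - {X}"

definition sentence :: "mso \<Rightarrow> bool" where
  "sentence \<phi> \<longleftrightarrow> free1 \<phi> = {} \<and> free2 \<phi> = {}"

text \<open>
  Satisfaction in the structure whose universe is the whole type \<open>'a\<close>, with its order, and
  whose unary predicate is interpreted by \<open>P\<close>. The set quantifiers range over all subsets.
\<close>

primrec sat :: "'a::linorder set \<Rightarrow> (nat \<Rightarrow> 'a) \<Rightarrow> (nat \<Rightarrow> 'a set) \<Rightarrow> mso \<Rightarrow> bool" where
  "sat P v V (Le x y) \<longleftrightarrow> v x \<le> v y"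
| "sat P v V (Eq x y) \<longleftrightarrow> v x = v y"
| "sat P v V (Pr x) \<longleftrightarrow> v x \<in> P"
| "sat P v V (Mem x X) \<longleftrightarrow> v x \<in> V X"
| "sat P v V (Neg \<phi>) \<longleftrightarrow> \<not> sat P v V \<phi>"
| "sat P v V (Conj \<phi> \<psi>) \<longleftrightarrow> sat P v V \<phi> \<and> sat P v V \<psi>"
| "sat P v V (Disj \<phi> \<psi>) \<longleftrightarrow> sat P v V \<phi> \<or> sat P v V \<psi>"
| "sat P v V (Ex1 x \<phi>) \<longleftrightarrow> (\<exists>a. sat P (v(x := a)) V \<phi>)"
| "sat P v V (All1 x \<phi>) \<longleftrightarrow> (\<forall>a. sat P (v(x := a)) V \<phi>)"
| "sat P v V (Ex2 X \<phi>) \<longleftrightarrow> (\<exists>A. sat P v (V(X := A)) \<phi>)"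
| "sat P v V (All2 X \<phi>) \<longleftrightarrow> (\<forall>A. sat P v (V(X := A)) \<phi>)"

lemma sat_cong:
  assumes "\<And>x. x \<in> free1 \<phi> \<Longrightarrow> v x = w x" and "\<And>X. X \<in> free2 \<phi> \<Longrightarrow> V X = W X"
  shows "sat P v V \<phi> \<longleftrightarrow> sat P w W \<phi>"
  using assms
proof (induction \<phi> arbitrary: v w V W)
  case (Conj \<phi> \<psi>)
  from Conj.IH(1)[of v w V W] Conj.IH(2)[of v w V W] Conj.prems show ?case by simp
next
  case (Disj \<phi> \<psi>)
  from Disj.IH(1)[of v w V W] Disj.IH(2)[of v w V W] Disj.prems show ?case by simp
next
  case (Neg \<phi>)
  from Neg.IH[of v w V W] Neg.prems show ?case by simp
next
  case (Ex1 x \<phi>)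
  have "sat P (v(x := a)) V \<phi> \<longleftrightarrow> sat P (w(x := a)) W \<phi>" for a
    by (rule Ex1.IH) (use Ex1.prems in auto)
  then show ?case by simp
next
  case (All1 x \<phi>)
  have "sat P (v(x := a)) V \<phi> \<longleftrightarrow> sat P (w(x := a)) W \<phi>" for a
    by (rule All1.IH) (use All1.prems in auto)
  then show ?case by simp
next
  case (Ex2 X \<phi>)
  have "sat P v (V(X := A)) \<phi> \<longleftrightarrow> sat P w (W(X := A)) \<phi>" for A
    by (rule Ex2.IH) (use Ex2.prems in auto)
  then show ?case by simp
next
  case (All2 X \<phi>)
  have "sat P v (V(X := A)) \<phi> \<longleftrightarrow> sat P w (W(X := A)) \<phi>" for A
    by (rule All2.IH) (use All2.prems in auto)
  then show ?case by simp
qed simp_all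

text \<open>The letters 0 and 1 are represented by \<^const>\<open>False\<close> and \<^const>\<open>True\<close>.\<close>

type_synonym biword = "int \<Rightarrow> bool"

text \<open>For a sentence the valuations are irrelevant, by \<open>sat_cong\<close>.\<close>

definition models :: "biword \<Rightarrow> mso \<Rightarrow> bool" where
  "models \<xi> \<phi> \<longleftrightarrow> (\<forall>v V. sat (\<xi> -` {True}) v V \<phi>)"

definition mso_equiv :: "biword \<Rightarrow> biword \<Rightarrow> bool" where
  "mso_equiv \<xi> \<eta> \<longleftrightarrow> (\<forall>\<phi>. sentence \<phi> \<longrightarrow> (models \<xi> \<phi> \<longleftrightarrow> models \<eta> \<phi>))"

definition mso_type :: "biword \<Rightarrow> biword set" where
  "mso_type \<xi> = {\<eta>. mso_equiv \<xi> \<eta>}"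

definition is_period :: "biword \<Rightarrow> nat \<Rightarrow> bool" where
  "is_period \<xi> p \<longleftrightarrow> p > 0 \<and> (\<forall>n. \<xi> n = \<xi> (n + int p))"

definition periodic :: "biword \<Rightarrow> bool" where
  "periodic \<xi> \<longleftrightarrow> (\<exists>p. is_period \<xi> p)"

definition period :: "biword \<Rightarrow> nat" where
  "period \<xi> = (LEAST p. is_period \<xi> p)"

text \<open>
  The factors of the restriction of \<open>\<xi>\<close> to an interval \<open>I\<close> of integers; the intervals used are
  \<open>UNIV\<close>, \<open>{..i}\<close> and \<open>{i..}\<close>.
\<close>

definition factors_on :: "int set \<Rightarrow> biword \<Rightarrow> bool list set" where
  "factors_on I \<xi> = {map \<xi> [k..l] | k l. k \<le> l \<and> {k..l} \<subseteq> I} \<union> {[]}"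

definition recurrent :: "biword \<Rightarrow> bool" where
  "recurrent \<xi> \<longleftrightarrow>
     (\<forall>i. factors_on UNIV \<xi> = factors_on {..i} \<xi> \<and> factors_on UNIV \<xi> = factors_on {i..} \<xi>)"

end

theory Submission
  imports Defs "HOL-Library.Omega_Words_Fun" "HOL-Library.Ramsey" "HOL-Library.Nat_Bijection"
begin

text \<open>
  The type of a word determines its set of factors. For a periodic word this already forces every
  equivalent word to be a shift. In a non-recurrent word the first or last occurrence of some factor
  is a definable position, so again the type consists of the shifts, which are now pairwise distinct.
  For recurrent words the set of factors conversely determines the type: by the composition method
  and Ramsey's theorem, what follows (or precedes) an occurrence of a factor whose class generates a
  minimal one-sided ideal in the finite semigroup of rank-\<open>k\<close> types depends only on that factor.
  If such a word is not periodic, every factor has two incompatible extensions, and a Cantor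
  scheme of factors produces continuum many recurrent words with the same factors.
\<close>

section \<open>Ehrenfeucht--Fraisse games for monadic second-order logic\<close>

text \<open>Ramsey's theorem alone describes a right half as a prefix \<open>s\<close> followed by
  an idempotent class \<open>w\<close> repeated forever, where \<open>s\<close> and \<open>w\<close>
  depend on the half. Minimality removes this dependence. If the cuts are placed at occurrences of a
  right minimal \<open>t\<close>, every such idempotent generates the same right ideal as
  \<open>t\<close>; two idempotents with the same right ideal are left identities for each other and
  therefore have equivalent omega-powers, and the prefix is absorbed because one of its powers is
  equivalent to the idempotent. The factor has to be minimal in both directions: the two halves are
  compared separately, and only an overlap in a common factor allows gluing them to whole words.
  Left halves are reduced to right halves by the reflection of the integers. In the Cantor scheme,
  agreement on growing windows alone would only bound the factors of the limit from above; the
  copies built into each refinement put every factor back, arbitrarily far out on both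
  sides.\<close>

definition atoms_agree ::
    "nat \<Rightarrow> int set \<Rightarrow> (nat \<Rightarrow> int set) \<Rightarrow> int set \<Rightarrow> (nat \<Rightarrow> int set) \<Rightarrow> bool" where
  "atoms_agree m I V J W \<longleftrightarrow>
    (\<forall>i<m. (V i \<inter> I = {} \<longleftrightarrow> W i \<inter> J = {}) \<and>
           ((\<exists>!x. x \<in> V i \<inter> I) \<longleftrightarrow> (\<exists>!x. x \<in> W i \<inter> J)) \<and>
           (\<forall>j<m. (V i \<inter> I \<subseteq> V j \<longleftrightarrow> W i \<inter> J \<subseteq> W j) \<and>
                  ((\<exists>x\<in>V i \<inter> I. \<exists>y\<in>V j \<inter> I. x < y) \<longleftrightarrow> (\<exists>x\<in>W i \<inter> J. \<exists>y\<in>W j \<inter> J. x < y))))"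

text \<open>
  \<open>mso_game m k I V J W\<close>: Duplicator survives \<open>k\<close> rounds on the ordered sets \<open>I\<close> and \<open>J\<close>
  expanded by the \<open>m\<close> unary predicates \<open>V\<close> and \<open>W\<close>; a round overwrites one of these predicates.
  Only the traces \<open>V i \<inter> I\<close> and \<open>W i \<inter> J\<close> matter. Elements are played as singletons.
\<close>

primrec mso_game ::
    "nat \<Rightarrow> nat \<Rightarrow> int set \<Rightarrow> (nat \<Rightarrow> int set) \<Rightarrow> int set \<Rightarrow> (nat \<Rightarrow> int set) \<Rightarrow> bool" where
  "mso_game m 0 I V J W \<longleftrightarrow> atoms_agree m I V J W"
| "mso_game m (Suc k) I V J W \<longleftrightarrow> mso_game m k I V J W \<and>
     (\<forall>i<m. (\<forall>A. \<exists>B. mso_game m k I (V(i := A)) J (W(i := B))) \<and>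
            (\<forall>B. \<exists>A. mso_game m k I (V(i := A)) J (W(i := B))))"

lemma mso_game_atoms: "mso_game m k I V J W \<Longrightarrow> atoms_agree m I V J W"
  by (induction k) auto

lemma mso_game_forth:
  "mso_game m (Suc k) I V J W \<Longrightarrow> i < m \<Longrightarrow> \<exists>B. mso_game m k I (V(i := A)) J (W(i := B))"
  by simp

lemma mso_game_back:
  "mso_game m (Suc k) I V J W \<Longrightarrow> i < m \<Longrightarrow> \<exists>A. mso_game m k I (V(i := A)) J (W(i := B))"
  by simp

lemma mso_game_refl: "mso_game m k I V I V"
  by (induction k arbitrary: V) (auto simp: atoms_agree_def)

lemma mso_game_sym: "mso_game m k I V J W \<Longrightarrow> mso_game m k J W I V"
proof (induction k arbitrary: V W)
  case 0
  then show ?case by (auto simp: atoms_agree_def)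
next
  case (Suc k)
  then show ?case by (simp, metis)
qed

lemma mso_game_trans:
  "mso_game m k I V J W \<Longrightarrow> mso_game m k J W K X \<Longrightarrow> mso_game m k I V K X"
proof (induction k arbitrary: V W X)
  case 0
  then show ?case by (simp add: atoms_agree_def)
next
  case (Suc k)
  then show ?case by (simp, metis)
qed

lemma ex1_image: "inj_on f S \<Longrightarrow> (\<exists>!x. x \<in> S) \<longleftrightarrow> (\<exists>!x. x \<in> f ` S)"
  unfolding inj_on_def by blast

text \<open>An order isomorphism is itself a strategy: sets are answered by images or
  preimages.\<close>

lemma mso_game_iso:
  assumes f: "bij_betw f I J" and mono: "strict_mono_on I f"
    and "\<And>i. i < m \<Longrightarrow> W i \<inter> J = f ` (V i \<inter> I)"
  shows "mso_game m k I V J W"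
  using assms(3)
proof (induction k arbitrary: V W)
  case 0
  have inj: "inj_on f I" and J: "J = f ` I" using f by (auto simp: bij_betw_def)
  have less: "f x < f y \<longleftrightarrow> x < y" if "x \<in> I" "y \<in> I" for x y
    using mono that by (metis linorder_neqE not_less_iff_gr_or_eq strict_mono_onD)
  have sub: "V i \<inter> I \<subseteq> V j \<longleftrightarrow> W i \<inter> J \<subseteq> W j" if "i < m" "j < m" for i j
  proof -
    have "V i \<inter> I \<subseteq> V j \<longleftrightarrow> V i \<inter> I \<subseteq> V j \<inter> I" by auto
    also have "\<dots> \<longleftrightarrow> f ` (V i \<inter> I) \<subseteq> f ` (V j \<inter> I)"
      by (auto simp: image_subset_iff inj_on_image_mem_iff[OF inj])
    also have "\<dots> \<longleftrightarrow> W i \<inter> J \<subseteq> W j \<inter> J" using 0 that by simp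
    finally show ?thesis by auto
  qed
  have one: "(\<exists>!x. x \<in> V i \<inter> I) \<longleftrightarrow> (\<exists>!x. x \<in> W i \<inter> J)" if "i < m" for i
    unfolding 0[OF that] by (rule ex1_image) (rule inj_on_subset[OF inj], simp)
  have lt: "(\<exists>x\<in>V i \<inter> I. \<exists>y\<in>V j \<inter> I. x < y) \<longleftrightarrow> (\<exists>x\<in>W i \<inter> J. \<exists>y\<in>W j \<inter> J. x < y)"
    if "i < m" "j < m" for i j
    unfolding 0[OF that(1)] 0[OF that(2)] using less by auto
  have "V i \<inter> I = {} \<longleftrightarrow> W i \<inter> J = {}" if "i < m" for i
    unfolding 0[OF that] by simp
  then show ?case using sub one lt by (simp add: atoms_agree_def)
next
  case (Suc k)
  have inj: "inj_on f I" and J: "J = f ` I" using f by (auto simp: bij_betw_def)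
  have "\<exists>B. mso_game m k I (V(i := A)) J (W(i := B))" for i A
    using Suc.prems J by (intro exI[of _ "f ` (A \<inter> I)"] Suc.IH) auto
  moreover have "\<exists>A. mso_game m k I (V(i := A)) J (W(i := B))" for i B
    using Suc.prems J by (intro exI[of _ "{x\<in>I. f x \<in> B}"] Suc.IH) auto
  ultimately show ?case using Suc by auto
qed

lemma mso_game_cong:
  assumes "\<And>i. i < m \<Longrightarrow> V i \<inter> I = W i \<inter> I"
  shows "mso_game m k I V I W"
  by (rule mso_game_iso[of id]) (use assms in \<open>auto intro: strict_mono_onI\<close>)

text \<open>Reversal turns the order atom for \<open>(i, j)\<close> into the one for
  \<open>(j, i)\<close>, and atoms are compared for all ordered pairs. This later reduces
  left-infinite halves to right-infinite ones.\<close>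

lemma mso_game_reflect:
  assumes "mso_game m k I V J W"
  shows "mso_game m k (uminus ` I) (\<lambda>i. uminus ` V i) (uminus ` J) (\<lambda>i. uminus ` W i)"
  using assms
proof (induction k arbitrary: V W)
  case 0
  have int: "uminus ` A \<inter> uminus ` B = uminus ` (A \<inter> B)" for A B :: "int set" by auto
  have ex1: "(\<exists>!x. x \<in> uminus ` A) \<longleftrightarrow> (\<exists>!x. x \<in> A)" for A :: "int set"
    by (rule ex1_image[symmetric]) simp
  have less: "(\<exists>x\<in>uminus ` A. \<exists>y\<in>uminus ` B. x < y) \<longleftrightarrow> (\<exists>x\<in>B. \<exists>y\<in>A. x < y)" for A B :: "int set"
    by auto
  have sub: "uminus ` A \<subseteq> uminus ` B \<longleftrightarrow> A \<subseteq> B" for A B :: "int set"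
    by (rule inj_image_subset_iff) simp
  have at: "V i \<inter> I = {} \<longleftrightarrow> W i \<inter> J = {}"
      "(\<exists>!x. x \<in> V i \<inter> I) \<longleftrightarrow> (\<exists>!x. x \<in> W i \<inter> J)"
      "V i \<inter> I \<subseteq> V j \<inter> I \<longleftrightarrow> W i \<inter> J \<subseteq> W j \<inter> J"
      "(\<exists>x\<in>V j \<inter> I. \<exists>y\<in>V i \<inter> I. x < y) \<longleftrightarrow> (\<exists>x\<in>W j \<inter> J. \<exists>y\<in>W i \<inter> J. x < y)"
    if "i < m" "j < m" for i j
    using 0 that by (simp_all add: atoms_agree_def)
  have sub': "uminus ` A \<inter> uminus ` K \<subseteq> uminus ` B \<longleftrightarrow> A \<inter> K \<subseteq> B \<inter> K" for A B K :: "int set"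
    unfolding int sub by auto
  show ?case
    unfolding mso_game.simps atoms_agree_def sub' unfolding int ex1 less
    using at by (intro allI impI conjI) (simp_all only: image_is_empty)
next
  case (Suc k)
  have upd: "(\<lambda>i. uminus ` (V(j := A)) i) = (\<lambda>i. uminus ` V i)(j := uminus ` A)"
    for V :: "nat \<Rightarrow> int set" and j A by (rule ext) simp
  have neg: "uminus ` uminus ` A = A" for A :: "int set" by (simp add: image_image)
  have step: "mso_game m k (uminus ` I) ((\<lambda>i. uminus ` V i)(j := uminus ` A))
                (uminus ` J) ((\<lambda>i. uminus ` W i)(j := uminus ` B))"
    if "mso_game m k I (V(j := A)) J (W(j := B))" for j A B
    using Suc.IH[OF that] unfolding upd .
  have "\<exists>B. mso_game m k (uminus ` I) ((\<lambda>i. uminus ` V i)(j := A))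
                (uminus ` J) ((\<lambda>i. uminus ` W i)(j := B))" if "j < m" for j A
  proof -
    obtain B where "mso_game m k I (V(j := uminus ` A)) J (W(j := B))"
      using mso_game_forth[OF Suc.prems \<open>j < m\<close>] by blast
    from step[OF this] show ?thesis unfolding neg by blast
  qed
  moreover have "\<exists>A. mso_game m k (uminus ` I) ((\<lambda>i. uminus ` V i)(j := A))
                (uminus ` J) ((\<lambda>i. uminus ` W i)(j := B))" if "j < m" for j B
  proof -
    obtain A where "mso_game m k I (V(j := A)) J (W(j := uminus ` B))"
      using mso_game_back[OF Suc.prems \<open>j < m\<close>] by blast
    from step[OF this] show ?thesis unfolding neg by blast
  qed
  moreover have "mso_game m k (uminus ` I) (\<lambda>i. uminus ` V i) (uminus ` J) (\<lambda>i. uminus ` W i)"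
    using Suc.prems by (intro Suc.IH) simp
  ultimately show ?case by simp
qed

text \<open>The composition method: strategies on the summands combine to one on the ordered sum.\<close>

lemma mso_game_sum:
  fixes A B :: "'i::linorder \<Rightarrow> int set"
  assumes A: "\<And>c d x y. c < d \<Longrightarrow> x \<in> A c \<Longrightarrow> y \<in> A d \<Longrightarrow> x < y"
    and B: "\<And>c d x y. c < d \<Longrightarrow> x \<in> B c \<Longrightarrow> y \<in> B d \<Longrightarrow> x < y"
    and "\<And>c. mso_game m k (A c) V (B c) W"
  shows "mso_game m k (\<Union>c. A c) V (\<Union>c. B c) W"
  using assms(3)
proof (induction k arbitrary: V W)
  case 0
  have at: "atoms_agree m (A c) V (B c) W" for c using 0 by simp
  have disjA: "c = d" if "x \<in> A c" "x \<in> A d" for c d x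
    using A that by (metis less_irrefl linorder_neqE)
  have disjB: "c = d" if "x \<in> B c" "x \<in> B d" for c d x
    using B that by (metis less_irrefl linorder_neqE)
  have emp: "V i \<inter> A c = {} \<longleftrightarrow> W i \<inter> B c = {}" if "i < m" for i c
    using at[of c] that by (auto simp: atoms_agree_def)
  have one: "(\<exists>!x. x \<in> V i \<inter> A c) \<longleftrightarrow> (\<exists>!x. x \<in> W i \<inter> B c)" if "i < m" for i c
    using at[of c] that by (simp add: atoms_agree_def)
  have sub: "V i \<inter> A c \<subseteq> V j \<longleftrightarrow> W i \<inter> B c \<subseteq> W j" if "i < m" "j < m" for i j c
    using at[of c] that by (simp add: atoms_agree_def)
  have lt: "(\<exists>x\<in>V i \<inter> A c. \<exists>y\<in>V j \<inter> A c. x < y) \<longleftrightarrow> (\<exists>x\<in>W i \<inter> B c. \<exists>y\<in>W j \<inter> B c. x < y)"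
    if "i < m" "j < m" for i j c
    using at[of c] that by (simp add: atoms_agree_def)
  \<comment> \<open>A set in a disjoint sum is a singleton exactly if one summand sees a singleton
    and the others see nothing; hence emptiness is recorded among the atoms beside
    uniqueness.\<close>
  have ex1: "(\<exists>!x. x \<in> U \<inter> (\<Union>c. C c)) \<longleftrightarrow>
      (\<exists>c. (\<exists>!x. x \<in> U \<inter> C c) \<and> (\<forall>d. d \<noteq> c \<longrightarrow> U \<inter> C d = {}))"
    if "\<And>c d x. x \<in> C c \<Longrightarrow> x \<in> C d \<Longrightarrow> c = d" for U and C :: "'i \<Rightarrow> int set"
  proof
    assume "\<exists>!x. x \<in> U \<inter> (\<Union>c. C c)"
    then obtain x where x: "x \<in> U" "x \<in> (\<Union>c. C c)"
      and uniq: "\<And>y. y \<in> U \<Longrightarrow> y \<in> (\<Union>c. C c) \<Longrightarrow> y = x" by blast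
    from x obtain c where c: "x \<in> C c" by blast
    have "\<exists>!x. x \<in> U \<inter> C c" using x c uniq by blast
    moreover have "U \<inter> C d = {}" if "d \<noteq> c" for d using that \<open>\<And>c d x. x \<in> C c \<Longrightarrow> x \<in> C d \<Longrightarrow> c = d\<close> uniq c by blast
    ultimately show "\<exists>c. (\<exists>!x. x \<in> U \<inter> C c) \<and> (\<forall>d. d \<noteq> c \<longrightarrow> U \<inter> C d = {})" by blast
  next
    assume "\<exists>c. (\<exists>!x. x \<in> U \<inter> C c) \<and> (\<forall>d. d \<noteq> c \<longrightarrow> U \<inter> C d = {})"
    then obtain c where c: "\<exists>!x. x \<in> U \<inter> C c" and emp: "\<And>d. d \<noteq> c \<Longrightarrow> U \<inter> C d = {}" by auto
    then have "U \<inter> (\<Union>c. C c) = U \<inter> C c" by fastforce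
    with c show "\<exists>!x. x \<in> U \<inter> (\<Union>c. C c)" by simp
  qed
  \<comment> \<open>Elements of different summands are ordered by their indices, so for such pairs
    only emptiness of the traces matters.\<close>
  have less: "(\<exists>x\<in>U \<inter> (\<Union>c. C c). \<exists>y\<in>T \<inter> (\<Union>c. C c). x < y) \<longleftrightarrow>
      (\<exists>c. \<exists>x\<in>U \<inter> C c. \<exists>y\<in>T \<inter> C c. x < y) \<or> (\<exists>c d. c < d \<and> U \<inter> C c \<noteq> {} \<and> T \<inter> C d \<noteq> {})"
    if "\<And>c d x y. c < d \<Longrightarrow> x \<in> C c \<Longrightarrow> y \<in> C d \<Longrightarrow> x < y" for U T and C :: "'i \<Rightarrow> int set"
  proof
    assume "\<exists>x\<in>U \<inter> (\<Union>c. C c). \<exists>y\<in>T \<inter> (\<Union>c. C c). x < y"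
    then obtain x y c d where xy: "x \<in> U" "x \<in> C c" "y \<in> T" "y \<in> C d" "x < y" by blast
    consider "c = d" | "c < d" | "d < c" by fastforce
    then show "(\<exists>c. \<exists>x\<in>U \<inter> C c. \<exists>y\<in>T \<inter> C c. x < y) \<or>
        (\<exists>c d. c < d \<and> U \<inter> C c \<noteq> {} \<and> T \<inter> C d \<noteq> {})"
    proof cases
      case 1
      with xy show ?thesis by blast
    next
      case 2
      with xy show ?thesis by blast
    next
      case 3
      with xy that[of d c y x] show ?thesis by simp
    qed
  next
    assume "(\<exists>c. \<exists>x\<in>U \<inter> C c. \<exists>y\<in>T \<inter> C c. x < y) \<or>
        (\<exists>c d. c < d \<and> U \<inter> C c \<noteq> {} \<and> T \<inter> C d \<noteq> {})"
    then show "\<exists>x\<in>U \<inter> (\<Union>c. C c). \<exists>y\<in>T \<inter> (\<Union>c. C c). x < y"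
    proof (elim disjE exE conjE)
      fix c d assume cd: "c < d" "U \<inter> C c \<noteq> {}" "T \<inter> C d \<noteq> {}"
      then obtain x y where "x \<in> U" "x \<in> C c" "y \<in> T" "y \<in> C d" by blast
      with that[OF cd(1), of x y] show ?thesis by blast
    qed blast
  qed
  have "V i \<inter> (\<Union>c. A c) = {} \<longleftrightarrow> W i \<inter> (\<Union>c. B c) = {}" if "i < m" for i
    using emp[OF that] by blast
  moreover have "(\<exists>!x. x \<in> V i \<inter> (\<Union>c. A c)) \<longleftrightarrow> (\<exists>!x. x \<in> W i \<inter> (\<Union>c. B c))" if "i < m" for i
  proof -
    have "(\<exists>!x. x \<in> V i \<inter> (\<Union>c. A c)) \<longleftrightarrow>
        (\<exists>c. (\<exists>!x. x \<in> V i \<inter> A c) \<and> (\<forall>d. d \<noteq> c \<longrightarrow> V i \<inter> A d = {}))"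
      by (rule ex1) (rule disjA)
    also have "\<dots> \<longleftrightarrow> (\<exists>c. (\<exists>!x. x \<in> W i \<inter> B c) \<and> (\<forall>d. d \<noteq> c \<longrightarrow> W i \<inter> B d = {}))"
      unfolding emp[OF that] one[OF that] ..
    also have "\<dots> \<longleftrightarrow> (\<exists>!x. x \<in> W i \<inter> (\<Union>c. B c))"
      by (rule ex1[symmetric]) (rule disjB)
    finally show ?thesis .
  qed
  moreover have "V i \<inter> (\<Union>c. A c) \<subseteq> V j \<longleftrightarrow> W i \<inter> (\<Union>c. B c) \<subseteq> W j" if "i < m" "j < m" for i j
    using sub[OF that] by blast
  moreover have "(\<exists>x\<in>V i \<inter> (\<Union>c. A c). \<exists>y\<in>V j \<inter> (\<Union>c. A c). x < y) \<longleftrightarrow>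
      (\<exists>x\<in>W i \<inter> (\<Union>c. B c). \<exists>y\<in>W j \<inter> (\<Union>c. B c). x < y)" if "i < m" "j < m" for i j
  proof -
    have "(\<exists>x\<in>V i \<inter> (\<Union>c. A c). \<exists>y\<in>V j \<inter> (\<Union>c. A c). x < y) \<longleftrightarrow>
        (\<exists>c. \<exists>x\<in>V i \<inter> A c. \<exists>y\<in>V j \<inter> A c. x < y) \<or>
        (\<exists>c d. c < d \<and> V i \<inter> A c \<noteq> {} \<and> V j \<inter> A d \<noteq> {})"
      by (rule less) (rule A)
    also have "\<dots> \<longleftrightarrow> (\<exists>c. \<exists>x\<in>W i \<inter> B c. \<exists>y\<in>W j \<inter> B c. x < y) \<or>
        (\<exists>c d. c < d \<and> W i \<inter> B c \<noteq> {} \<and> W j \<inter> B d \<noteq> {})"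
      unfolding emp[OF that(1)] emp[OF that(2)] lt[OF that] ..
    also have "\<dots> \<longleftrightarrow> (\<exists>x\<in>W i \<inter> (\<Union>c. B c). \<exists>y\<in>W j \<inter> (\<Union>c. B c). x < y)"
      by (rule less[symmetric]) (rule B)
    finally show ?thesis .
  qed
  ultimately show ?case by (simp add: atoms_agree_def)
next
  case (Suc k)
  \<comment> \<open>Duplicator answers with \<open>T c\<close> in each summand and plays the union
    of the traces \<open>T c \<inter> C c\<close>; by disjointness no summand can tell this union
    from its own \<open>T c\<close>.\<close>
  have glue: "mso_game m k I (V(i := S)) (C c) (W(i := \<Union>c. T c \<inter> C c))"
    if "mso_game m k I (V(i := S)) (C c) (W(i := T c))"
      and "\<And>c d x y. c < d \<Longrightarrow> x \<in> C c \<Longrightarrow> y \<in> C d \<Longrightarrow> x < y"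
    for I i S T c V W and C :: "'i \<Rightarrow> int set"
  proof -
    have "(\<Union>c. T c \<inter> C c) \<inter> C c = T c \<inter> C c"
      using that(2) by auto (metis less_irrefl linorder_neqE)
    then have "mso_game m k (C c) (W(i := T c)) (C c) (W(i := \<Union>c. T c \<inter> C c))"
      by (intro mso_game_cong) simp
    with that(1) show ?thesis by (rule mso_game_trans)
  qed
  have "\<exists>S'. mso_game m k (\<Union>c. A c) (V(i := S)) (\<Union>c. B c) (W(i := S'))" if "i < m" for i S
  proof -
    have "\<forall>c. \<exists>T. mso_game m k (A c) (V(i := S)) (B c) (W(i := T))"
      using Suc.prems that by simp
    then obtain T where "\<And>c. mso_game m k (A c) (V(i := S)) (B c) (W(i := T c))" by metis
    then show ?thesis
      using glue[of _ V i S B _ W T] B by (blast intro: Suc.IH)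
  qed
  moreover have "\<exists>S. mso_game m k (\<Union>c. A c) (V(i := S)) (\<Union>c. B c) (W(i := S'))" if "i < m" for i S'
  proof -
    have "\<forall>c. \<exists>T. mso_game m k (A c) (V(i := T)) (B c) (W(i := S'))"
      using Suc.prems that by simp
    then obtain T where "\<And>c. mso_game m k (A c) (V(i := T c)) (B c) (W(i := S'))" by metis
    then have "mso_game m k (A c) (V(i := \<Union>c. T c \<inter> A c)) (B c) (W(i := S'))" for c
      using glue[of _ W i S' A _ V T] A by (blast intro: mso_game_sym)
    then show ?thesis by (blast intro: Suc.IH)
  qed
  ultimately show ?case using Suc by simp
qed

lemma mso_game_Un:
  assumes "\<And>x y. x \<in> I \<Longrightarrow> y \<in> I' \<Longrightarrow> x < y" and "\<And>x y. x \<in> J \<Longrightarrow> y \<in> J' \<Longrightarrow> x < y"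
    and "mso_game m k I V J W" and "mso_game m k I' V J' W"
  shows "mso_game m k (I \<union> I') V (J \<union> J') W"
proof -
  \<comment> \<open>\<open>False < True\<close>, so \<open>bool\<close> as index set puts
    \<open>I\<close> before \<open>I'\<close>.\<close>
  have "mso_game m k (\<Union>b. if b then I' else I) V (\<Union>b. if b then J' else J) W"
    by (rule mso_game_sum) (use assms in auto)
  moreover have "(\<Union>b. if b then S' else S) = S \<union> S'" for S S' :: "int set"
    by (auto simp: UNIV_bool)
  ultimately show ?thesis by simp
qed

text \<open>A class for \<open>Suc k\<close> rounds is fixed by the class for \<open>k\<close>
  rounds and the classes reachable by overwriting one slot. Classes are coded by natural numbers
  because these nested descriptions would otherwise change their type in every round.\<close>

lemma mso_game_finite_index:
  "\<exists>h :: int set \<times> (nat \<Rightarrow> int set) \<Rightarrow> nat. finite (range h) \<and>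
     (\<forall>I V J W. h (I, V) = h (J, W) \<longrightarrow> mso_game m k I V J W)"
proof -
  have to_nat: "\<exists>h :: int set \<times> (nat \<Rightarrow> int set) \<Rightarrow> nat. finite (range h) \<and>
      (\<forall>x y. h x = h y \<longrightarrow> g x = g y)"
    if "finite (range g)" for g :: "int set \<times> (nat \<Rightarrow> int set) \<Rightarrow> 'b"
  proof -
    obtain n and e :: "'b \<Rightarrow> nat" where "inj_on e (range g)"
      using finite_imp_inj_to_nat_seg[OF \<open>finite (range g)\<close>] by blast
    moreover have "range (e \<circ> g) = e ` range g" by auto
    ultimately show ?thesis
      using that by (intro exI[of _ "e \<circ> g"]) (auto simp: inj_on_def)
  qed
  show ?thesis
  proof (induction k)
    case 0
    define N where "N = {..<m}"
    define g where "g = (\<lambda>(I :: int set, V :: nat \<Rightarrow> int set).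
      ({i\<in>N. V i \<inter> I = {}}, {i\<in>N. \<exists>!x. x \<in> V i \<inter> I}, {(i, j) \<in> N \<times> N. V i \<inter> I \<subseteq> V j},
       {(i, j) \<in> N \<times> N. \<exists>x\<in>V i \<inter> I. \<exists>y\<in>V j \<inter> I. x < y}))"
    have "range g \<subseteq> Pow N \<times> Pow N \<times> Pow (N \<times> N) \<times> Pow (N \<times> N)"
      by (auto simp: g_def)
    then have "finite (range g)" by (rule finite_subset) (simp add: N_def)
    moreover have "atoms_agree m I V J W" if "g (I, V) = g (J, W)" for I V J W
    proof -
      have eq: "{i\<in>N. V i \<inter> I = {}} = {i\<in>N. W i \<inter> J = {}}"
          "{i\<in>N. \<exists>!x. x \<in> V i \<inter> I} = {i\<in>N. \<exists>!x. x \<in> W i \<inter> J}"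
          "{(i, j) \<in> N \<times> N. V i \<inter> I \<subseteq> V j} = {(i, j) \<in> N \<times> N. W i \<inter> J \<subseteq> W j}"
          "{(i, j) \<in> N \<times> N. \<exists>x\<in>V i \<inter> I. \<exists>y\<in>V j \<inter> I. x < y} =
           {(i, j) \<in> N \<times> N. \<exists>x\<in>W i \<inter> J. \<exists>y\<in>W j \<inter> J. x < y}"
        using that by (simp_all only: g_def prod.case prod.inject)
      have "V i \<inter> I = {} \<longleftrightarrow> W i \<inter> J = {}"
          "(\<exists>!x. x \<in> V i \<inter> I) \<longleftrightarrow> (\<exists>!x. x \<in> W i \<inter> J)" if "i < m" for i
        using eq(1,2)[THEN eqset_imp_iff, of i] that by (simp_all add: N_def)
      moreover have "V i \<inter> I \<subseteq> V j \<longleftrightarrow> W i \<inter> J \<subseteq> W j"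
          "(\<exists>x\<in>V i \<inter> I. \<exists>y\<in>V j \<inter> I. x < y) \<longleftrightarrow> (\<exists>x\<in>W i \<inter> J. \<exists>y\<in>W j \<inter> J. x < y)"
        if "i < m" "j < m" for i j
        using eq(3,4)[THEN eqset_imp_iff, of "(i, j)"] that by (simp_all add: N_def)
      ultimately show ?thesis by (simp add: atoms_agree_def)
    qed
    ultimately show ?case using to_nat[of g] by (simp, blast)
  next
    case (Suc k)
    then obtain h :: "int set \<times> (nat \<Rightarrow> int set) \<Rightarrow> nat" where fin: "finite (range h)"
      and h: "\<And>I V J W. h (I, V) = h (J, W) \<Longrightarrow> mso_game m k I V J W" by blast
    define g where "g = (\<lambda>(I, V). (h (I, V), {(i, h (I, V(i := A))) | i A. i < m}))"
    have "range g \<subseteq> range h \<times> Pow ({..<m} \<times> range h)" by (auto simp: g_def)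
    then have "finite (range g)" by (rule finite_subset) (simp add: fin)
    moreover have "mso_game m (Suc k) I V J W" if "g (I, V) = g (J, W)" for I V J W
    proof -
      have eq: "h (I, V) = h (J, W)"
          "{(i, h (I, V(i := A))) | i A. i < m} = {(i, h (J, W(i := A))) | i A. i < m}"
        using that by (auto simp: g_def)
      have "\<exists>B. mso_game m k I (V(i := A)) J (W(i := B))" if "i < m" for i A
      proof -
        have "(i, h (I, V(i := A))) \<in> {(i, h (J, W(i := A))) | i A. i < m}"
          unfolding eq(2)[symmetric] using that by blast
        then show ?thesis using h by blast
      qed
      moreover have "\<exists>A. mso_game m k I (V(i := A)) J (W(i := B))" if "i < m" for i B
      proof -
        have "(i, h (J, W(i := B))) \<in> {(i, h (I, V(i := A))) | i A. i < m}"
          unfolding eq(2) using that by blast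
        then obtain A where "h (I, V(i := A)) = h (J, W(i := B))" by auto
        then show ?thesis using h by blast
      qed
      ultimately show ?thesis using h[OF eq(1)] by simp
    qed
    ultimately show ?case using to_nat[of g] by (simp del: mso_game.simps, blast)
  qed
qed

section \<open>From game equivalence to equal truth values of formulas\<close>

primrec quantifier_rank :: "mso \<Rightarrow> nat" where
  "quantifier_rank (Le x y) = 0"
| "quantifier_rank (Eq x y) = 0"
| "quantifier_rank (Pr x) = 0"
| "quantifier_rank (Mem x X) = 0"
| "quantifier_rank (Neg \<phi>) = quantifier_rank \<phi>"
| "quantifier_rank (Conj \<phi> \<psi>) = max (quantifier_rank \<phi>) (quantifier_rank \<psi>)"
| "quantifier_rank (Disj \<phi> \<psi>) = max (quantifier_rank \<phi>) (quantifier_rank \<psi>)"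
| "quantifier_rank (Ex1 x \<phi>) = Suc (quantifier_rank \<phi>)"
| "quantifier_rank (All1 x \<phi>) = Suc (quantifier_rank \<phi>)"
| "quantifier_rank (Ex2 X \<phi>) = Suc (quantifier_rank \<phi>)"
| "quantifier_rank (All2 X \<phi>) = Suc (quantifier_rank \<phi>)"

text \<open>Slot 0 of a game is reserved for the letters, odd slots for elements, even ones for sets.\<close>

primrec slots :: "mso \<Rightarrow> nat set" where
  "slots (Le x y) = {2 * x + 1, 2 * y + 1}"
| "slots (Eq x y) = {2 * x + 1, 2 * y + 1}"
| "slots (Pr x) = {0, 2 * x + 1}"
| "slots (Mem x X) = {2 * x + 1, 2 * X + 2}"
| "slots (Neg \<phi>) = slots \<phi>"
| "slots (Conj \<phi> \<psi>) = slots \<phi> \<union> slots \<psi>"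
| "slots (Disj \<phi> \<psi>) = slots \<phi> \<union> slots \<psi>"
| "slots (Ex1 x \<phi>) = insert (2 * x + 1) (slots \<phi>)"
| "slots (All1 x \<phi>) = insert (2 * x + 1) (slots \<phi>)"
| "slots (Ex2 X \<phi>) = insert (2 * X + 2) (slots \<phi>)"
| "slots (All2 X \<phi>) = insert (2 * X + 2) (slots \<phi>)"

lemma finite_slots: "finite (slots \<phi>)"
  by (induction \<phi>) auto

lemma mso_game_mono: "mso_game m k I V J W \<Longrightarrow> l \<le> k \<Longrightarrow> mso_game m l I V J W"
  by (induction k) (auto simp: le_Suc_eq simp del: mso_game.simps(2) dest: mso_game.simps(2)[THEN iffD1])

text \<open>Slots of variables that are not free stay unconstrained: a quantifier may overwrite its
  slot whatever it holds, and a sentence can start with all slots but 0 empty.\<close>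

definition encodes :: "mso \<Rightarrow> int set \<Rightarrow> (nat \<Rightarrow> int) \<Rightarrow> (nat \<Rightarrow> int set) \<Rightarrow> (nat \<Rightarrow> int set) \<Rightarrow> bool" where
  "encodes \<phi> P v V U \<longleftrightarrow> U 0 = P \<and> (\<forall>x\<in>free1 \<phi>. U (2 * x + 1) = {v x}) \<and>
     (\<forall>X\<in>free2 \<phi>. U (2 * X + 2) = V X)"

text \<open>Being a singleton is an atom, and atoms agree in every position that Duplicator
  survives, so the answer to a singleton is a singleton.\<close>

lemma mso_game_element:
  assumes "mso_game m (Suc k) UNIV U UNIV U'" and "i < m"
  shows "\<exists>b. mso_game m k UNIV (U(i := {a})) UNIV (U'(i := {b}))"
proof -
  obtain B where B: "mso_game m k UNIV (U(i := {a})) UNIV (U'(i := B))"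
    using mso_game_forth[OF assms] by blast
  from mso_game_atoms[OF this] \<open>i < m\<close> have "\<exists>!x. x \<in> B"
    by (auto simp: atoms_agree_def)
  then obtain b where "B = {b}" by blast
  with B show ?thesis by blast
qed

lemma sat_mso_game:
  assumes "mso_game m (quantifier_rank \<phi>) UNIV U UNIV U'" and "slots \<phi> \<subseteq> {..<m}"
    and "encodes \<phi> P v V U" and "encodes \<phi> P' v' V' U'"
  shows "sat P v V \<phi> \<longleftrightarrow> sat P' v' V' \<phi>"
  using assms
proof (induction \<phi> arbitrary: U U' v v' V V')
  case (Le x y)
  \<comment> \<open>The order atom is strict, so \<open>x \<le> y\<close> is read off as the failure
    of \<open>y < x\<close>.\<close>
  then have "(\<exists>a\<in>U (2 * y + 1). \<exists>b\<in>U (2 * x + 1). a < b) \<longleftrightarrow>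
      (\<exists>a\<in>U' (2 * y + 1). \<exists>b\<in>U' (2 * x + 1). a < b)"
    by (simp add: atoms_agree_def)
  with Le show ?case by (auto simp: encodes_def)
next
  case (Eq x y)
  then have "U (2 * x + 1) \<subseteq> U (2 * y + 1) \<longleftrightarrow> U' (2 * x + 1) \<subseteq> U' (2 * y + 1)"
    by (simp add: atoms_agree_def)
  with Eq show ?case by (simp add: encodes_def)
next
  case (Pr x)
  then have "U (2 * x + 1) \<subseteq> U 0 \<longleftrightarrow> U' (2 * x + 1) \<subseteq> U' 0"
    by (simp add: atoms_agree_def)
  with Pr show ?case by (simp add: encodes_def)
next
  case (Mem x X)
  then have "U (2 * x + 1) \<subseteq> U (2 * X + 2) \<longleftrightarrow> U' (2 * x + 1) \<subseteq> U' (2 * X + 2)"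
    by (simp add: atoms_agree_def)
  with Mem show ?case by (simp add: encodes_def)
next
  case (Neg \<phi>)
  then show ?case using Neg.IH[of U U' v V v' V'] by (simp add: encodes_def)
next
  case (Conj \<phi> \<psi>)
  then have "mso_game m (quantifier_rank \<phi>) UNIV U UNIV U'" "mso_game m (quantifier_rank \<psi>) UNIV U UNIV U'"
    by (auto intro: mso_game_mono)
  moreover have "encodes \<phi> P v V U" "encodes \<phi> P' v' V' U'" "encodes \<psi> P v V U" "encodes \<psi> P' v' V' U'"
    using Conj.prems(3,4) by (simp_all add: encodes_def)
  ultimately show ?case using Conj.IH(1)[of U U' v V v' V'] Conj.IH(2)[of U U' v V v' V'] Conj.prems(2)
    by simp
next
  case (Disj \<phi> \<psi>)
  then have "mso_game m (quantifier_rank \<phi>) UNIV U UNIV U'" "mso_game m (quantifier_rank \<psi>) UNIV U UNIV U'"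
    by (auto intro: mso_game_mono)
  moreover have "encodes \<phi> P v V U" "encodes \<phi> P' v' V' U'" "encodes \<psi> P v V U" "encodes \<psi> P' v' V' U'"
    using Disj.prems(3,4) by (simp_all add: encodes_def)
  ultimately show ?case using Disj.IH(1)[of U U' v V v' V'] Disj.IH(2)[of U U' v V v' V'] Disj.prems(2)
    by simp
next
  case (Ex1 x \<phi>)
  let ?i = "2 * x + 1"
  have i: "?i < m" and sl: "slots \<phi> \<subseteq> {..<m}" using Ex1.prems(2) by auto
  have parity: "2 * X + 2 \<noteq> 2 * x + 1" for X :: nat by presburger
  have enc: "encodes \<phi> P (v(x := a)) V (U(?i := {a}))" "encodes \<phi> P' (v'(x := a)) V' (U'(?i := {a}))" for a
    using Ex1.prems(3,4) parity by (auto simp: encodes_def)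
  have IH: "sat P (v(x := a)) V \<phi> \<longleftrightarrow> sat P' (v'(x := b)) V' \<phi>"
    if "mso_game m (quantifier_rank \<phi>) UNIV (U(?i := {a})) UNIV (U'(?i := {b}))" for a b
    by (rule Ex1.IH[OF that sl enc])
  have game: "mso_game m (Suc (quantifier_rank \<phi>)) UNIV U UNIV U'"
    using Ex1.prems(1) by simp
  have "\<exists>b. sat P (v(x := a)) V \<phi> \<longleftrightarrow> sat P' (v'(x := b)) V' \<phi>" for a
    using mso_game_element[OF game i] IH by blast
  moreover have "\<exists>a. sat P (v(x := a)) V \<phi> \<longleftrightarrow> sat P' (v'(x := b)) V' \<phi>" for b
    using mso_game_element[OF mso_game_sym[OF game] i] IH mso_game_sym by blast
  ultimately show ?case by (simp, metis)
next
  case (All1 x \<phi>)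
  let ?i = "2 * x + 1"
  have i: "?i < m" and sl: "slots \<phi> \<subseteq> {..<m}" using All1.prems(2) by auto
  have parity: "2 * X + 2 \<noteq> 2 * x + 1" for X :: nat by presburger
  have enc: "encodes \<phi> P (v(x := a)) V (U(?i := {a}))" "encodes \<phi> P' (v'(x := a)) V' (U'(?i := {a}))" for a
    using All1.prems(3,4) parity by (auto simp: encodes_def)
  have IH: "sat P (v(x := a)) V \<phi> \<longleftrightarrow> sat P' (v'(x := b)) V' \<phi>"
    if "mso_game m (quantifier_rank \<phi>) UNIV (U(?i := {a})) UNIV (U'(?i := {b}))" for a b
    by (rule All1.IH[OF that sl enc])
  have game: "mso_game m (Suc (quantifier_rank \<phi>)) UNIV U UNIV U'"
    using All1.prems(1) by simp
  have "\<exists>b. sat P (v(x := a)) V \<phi> \<longleftrightarrow> sat P' (v'(x := b)) V' \<phi>" for a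
    using mso_game_element[OF game i] IH by blast
  moreover have "\<exists>a. sat P (v(x := a)) V \<phi> \<longleftrightarrow> sat P' (v'(x := b)) V' \<phi>" for b
    using mso_game_element[OF mso_game_sym[OF game] i] IH mso_game_sym by blast
  ultimately show ?case by (simp, metis)
next
  case (Ex2 X \<phi>)
  let ?i = "2 * X + 2"
  have i: "?i < m" and sl: "slots \<phi> \<subseteq> {..<m}" using Ex2.prems(2) by auto
  have parity: "2 * x \<noteq> Suc (2 * X)" for x :: nat by presburger
  have enc: "encodes \<phi> P v (V(X := A)) (U(?i := A))" "encodes \<phi> P' v' (V'(X := A)) (U'(?i := A))" for A
    using Ex2.prems(3,4) parity by (auto simp: encodes_def)
  have IH: "sat P v (V(X := A)) \<phi> \<longleftrightarrow> sat P' v' (V'(X := B)) \<phi>"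
    if "mso_game m (quantifier_rank \<phi>) UNIV (U(?i := A)) UNIV (U'(?i := B))" for A B
    by (rule Ex2.IH[OF that sl enc])
  have "\<exists>B. sat P v (V(X := A)) \<phi> \<longleftrightarrow> sat P' v' (V'(X := B)) \<phi>" for A
    using Ex2.prems(1) i IH by simp metis
  moreover have "\<exists>A. sat P v (V(X := A)) \<phi> \<longleftrightarrow> sat P' v' (V'(X := B)) \<phi>" for B
    using Ex2.prems(1) i IH by simp metis
  ultimately show ?case by (simp, metis)
next
  case (All2 X \<phi>)
  let ?i = "2 * X + 2"
  have i: "?i < m" and sl: "slots \<phi> \<subseteq> {..<m}" using All2.prems(2) by auto
  have parity: "2 * x \<noteq> Suc (2 * X)" for x :: nat by presburger
  have enc: "encodes \<phi> P v (V(X := A)) (U(?i := A))" "encodes \<phi> P' v' (V'(X := A)) (U'(?i := A))" for A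
    using All2.prems(3,4) parity by (auto simp: encodes_def)
  have IH: "sat P v (V(X := A)) \<phi> \<longleftrightarrow> sat P' v' (V'(X := B)) \<phi>"
    if "mso_game m (quantifier_rank \<phi>) UNIV (U(?i := A)) UNIV (U'(?i := B))" for A B
    by (rule All2.IH[OF that sl enc])
  have "\<exists>B. sat P v (V(X := A)) \<phi> \<longleftrightarrow> sat P' v' (V'(X := B)) \<phi>" for A
    using All2.prems(1) i IH by simp metis
  moreover have "\<exists>A. sat P v (V(X := A)) \<phi> \<longleftrightarrow> sat P' v' (V'(X := B)) \<phi>" for B
    using All2.prems(1) i IH by simp metis
  ultimately show ?case by (simp, metis)
qed

section \<open>Finite congruences on words\<close>

text \<open>A finite omega-semigroup in axioms: finite words modulo \<open>leq\<close> form a finite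
  monoid, and \<open>weq_factorization\<close> makes infinite products of its classes well defined.
  The algebra that follows thus uses nothing about games.\<close>

locale omega_congruence =
  fixes leq :: "'a list \<Rightarrow> 'a list \<Rightarrow> bool" (infix \<open>\<simeq>\<close> 50)
    and weq :: "'a word \<Rightarrow> 'a word \<Rightarrow> bool"
  assumes leq_refl: "u \<simeq> u"
    and leq_sym: "u \<simeq> v \<Longrightarrow> v \<simeq> u"
    and leq_trans [trans]: "u \<simeq> v \<Longrightarrow> v \<simeq> w \<Longrightarrow> u \<simeq> w"
    and leq_append: "u \<simeq> u' \<Longrightarrow> v \<simeq> v' \<Longrightarrow> u @ v \<simeq> u' @ v'"
    and leq_finite_index: "\<exists>h :: 'a list \<Rightarrow> nat. finite (range h) \<and> (\<forall>u v. h u = h v \<longrightarrow> u \<simeq> v)"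
    and weq_sym: "weq \<sigma> \<tau> \<Longrightarrow> weq \<tau> \<sigma>"
    and weq_trans [trans]: "weq \<sigma> \<tau> \<Longrightarrow> weq \<tau> \<rho> \<Longrightarrow> weq \<sigma> \<rho>"
    and weq_conc: "u \<simeq> v \<Longrightarrow> weq \<sigma> \<tau> \<Longrightarrow> weq (u \<frown> \<sigma>) (v \<frown> \<tau>)"
    and weq_factorization: "idx_sequence p \<Longrightarrow> idx_sequence q \<Longrightarrow>
      (\<And>i. subsequence \<sigma> (p i) (p (Suc i)) \<simeq> subsequence \<tau> (q i) (q (Suc i))) \<Longrightarrow> weq \<sigma> \<tau>"
begin

definition cls :: "'a list \<Rightarrow> 'a list set" where
  "cls u = {v. u \<simeq> v}"

lemma cls_eq_iff: "cls u = cls v \<longleftrightarrow> u \<simeq> v"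
  unfolding cls_def using leq_refl leq_sym leq_trans by blast

lemma finite_range_cls: "finite (range cls)"
proof -
  obtain h :: "'a list \<Rightarrow> nat" where h: "finite (range h)" "\<And>u v. h u = h v \<Longrightarrow> u \<simeq> v"
    using leq_finite_index by blast
  have "cls u = cls (inv h (h u))" for u
    using h(2) by (simp add: cls_eq_iff f_inv_into_f)
  then have "range cls \<subseteq> (\<lambda>n. cls (inv h n)) ` range h" by blast
  then show ?thesis using h(1) finite_surj by blast
qed

lemma weq_iter:
  assumes "u \<noteq> []" and "v \<noteq> []" and "u \<simeq> v"
  shows "weq (u\<^sup>\<omega>) (v\<^sup>\<omega>)"
proof (rule weq_factorization[of "\<lambda>i. i * length u" "\<lambda>i. i * length v"])
  have block: "subsequence (w\<^sup>\<omega>) (i * length w) (Suc i * length w) = w" if "w \<noteq> []" for i and w :: "'a list"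
    using that by (intro nth_equalityI) simp_all
  show "subsequence (u\<^sup>\<omega>) (i * length u) (Suc i * length u) \<simeq> subsequence (v\<^sup>\<omega>) (i * length v) (Suc i * length v)" for i
    unfolding block[OF assms(1)] block[OF assms(2)] by (rule assms(3))
qed (use assms in \<open>auto simp: idx_sequence_def\<close>)

end

section \<open>Identities between omega-powers\<close>

lemma iter_unique:
  assumes "u \<noteq> []" and "\<sigma> = u \<frown> \<sigma>"
  shows "\<sigma> = u\<^sup>\<omega>"
proof
  fix n
  show "\<sigma> n = u\<^sup>\<omega> n"
  proof (induction n rule: less_induct)
    case (less n)
    show ?case
    proof (cases "n < length u")
      case True
      then show ?thesis using assms(1) by (subst assms(2)) simp
    next
      case False
      then have "\<sigma> n = \<sigma> (n - length u)" by (subst assms(2)) simp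
      also have "\<dots> = u\<^sup>\<omega> (n - length u)" using False assms(1) by (intro less) (cases u, auto)
      also have "\<dots> = u\<^sup>\<omega> n" using False assms(1) by (simp add: mod_if[of n])
      finally show ?thesis .
    qed
  qed
qed

primrec list_power :: "'a list \<Rightarrow> nat \<Rightarrow> 'a list" where
  "list_power u 0 = []"
| "list_power u (Suc n) = u @ list_power u n"

lemma list_power_add: "list_power u (m + n) = list_power u m @ list_power u n"
  by (induction m) simp_all

text \<open>Both sides are fixed points of prefixing \<open>list_power u n\<close>, and a nonempty
  prefix determines its fixed point.\<close>

lemma iter_list_power:
  assumes "u \<noteq> []" and "n > 0"
  shows "(list_power u n)\<^sup>\<omega> = u\<^sup>\<omega>"
proof -
  have "u\<^sup>\<omega> = list_power u n \<frown> u\<^sup>\<omega>"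
  proof (induction n)
    case (Suc n)
    have "u\<^sup>\<omega> = u \<frown> u\<^sup>\<omega>" using assms(1) by (intro iter_unroll) simp
    also have "\<dots> = u \<frown> list_power u n \<frown> u\<^sup>\<omega>" using Suc by simp
    finally show ?case by simp
  qed simp
  moreover have "list_power u n \<noteq> []" using assms by (cases n) auto
  ultimately show ?thesis using iter_unique by metis
qed

lemma iter_append:
  assumes "u @ v \<noteq> []"
  shows "(u @ v)\<^sup>\<omega> = u \<frown> (v @ u)\<^sup>\<omega>"
proof (rule iter_unique[symmetric, OF assms])
  have "(v @ u)\<^sup>\<omega> = (v @ u) \<frown> (v @ u)\<^sup>\<omega>"
    using assms by (intro iter_unroll) auto
  then have "u \<frown> (v @ u)\<^sup>\<omega> = u \<frown> (v @ u) \<frown> (v @ u)\<^sup>\<omega>"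
    by presburger
  also have "\<dots> = (u @ v) \<frown> u \<frown> (v @ u)\<^sup>\<omega>"
    unfolding conc_conc append_assoc ..
  finally show "u \<frown> (v @ u)\<^sup>\<omega> = (u @ v) \<frown> u \<frown> (v @ u)\<^sup>\<omega>" .
qed

section \<open>Minimal right ideals and Ramsey factorizations\<close>

context omega_congruence
begin

text \<open>
  In terms of the finite semigroup of classes, \<open>right_minimal F t\<close> says that no right
  extension of \<open>t\<close> within \<open>F\<close> generates a smaller right ideal than \<open>t\<close>.
\<close>

definition right_minimal :: "'a list set \<Rightarrow> 'a list \<Rightarrow> bool" where
  "right_minimal F t \<longleftrightarrow> (\<forall>v. t @ v \<in> F \<longrightarrow> (\<exists>x. t @ v @ x \<simeq> t))"

text \<open>Take a word of \<open>F\<close> whose right ideal has the fewest classes: extending it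
  within \<open>F\<close> cannot shrink the ideal, so its own class stays reachable. The ideal
  ranges over all extensions, also those that leave \<open>F\<close>.\<close>

lemma ex_right_minimal:
  assumes "F \<noteq> {}"
  shows "\<exists>t\<in>F. right_minimal F t"
proof -
  define ideal where "ideal t = (\<lambda>x. cls (t @ x)) ` UNIV" for t
  have fin: "finite (ideal t)" for t
    using finite_range_cls by (rule rev_finite_subset) (auto simp: ideal_def)
  obtain t where t: "t \<in> F" and least: "\<And>t'. t' \<in> F \<Longrightarrow> card (ideal t) \<le> card (ideal t')"
    using assms ex_has_least_nat[of "\<lambda>t. t \<in> F" _ "card \<circ> ideal"] by auto
  have "\<exists>x. t @ v @ x \<simeq> t" if "t @ v \<in> F" for v
  proof -
    have "ideal (t @ v) \<subseteq> ideal t"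
    proof
      fix c assume "c \<in> ideal (t @ v)"
      then obtain x where "c = cls (t @ (v @ x))" by (auto simp: ideal_def)
      then show "c \<in> ideal t" by (simp add: ideal_def)
    qed
    then have "ideal (t @ v) = ideal t"
      using least[OF that] fin by (intro card_seteq) auto
    moreover have "cls (t @ []) \<in> ideal t" unfolding ideal_def by (rule rangeI)
    ultimately have "cls (t @ []) \<in> ideal (t @ v)" by simp
    then obtain x where "cls (t @ []) = cls ((t @ v) @ x)" unfolding ideal_def by (rule rangeE)
    then have "t \<simeq> t @ v @ x" by (simp add: cls_eq_iff)
    then show ?thesis using leq_sym by blast
  qed
  then show ?thesis using t by (auto simp: right_minimal_def)
qed

text \<open>Any return to \<open>t\<close> becomes a return to \<open>t @ v\<close> once
  \<open>v\<close> is appended. This allows lengthening a minimal factor to one that is minimal in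
  both directions.\<close>

lemma right_minimal_append:
  assumes "right_minimal F t"
  shows "right_minimal F (t @ v)"
  unfolding right_minimal_def
proof (intro allI impI)
  fix w assume "(t @ v) @ w \<in> F"
  then obtain x where "t @ (v @ w) @ x \<simeq> t"
    using assms by (auto simp: right_minimal_def)
  then have "(t @ (v @ w) @ x) @ v \<simeq> t @ v" using leq_refl by (rule leq_append)
  then show "\<exists>x. (t @ v) @ w @ x \<simeq> t @ v" by auto
qed

text \<open>A pair of positions is coloured by the class of the segment between them. The distance
  \<open>d\<close> leaves room for a word of length \<open>d\<close> after each cut and before the
  first one.\<close>

lemma ramsey_factorization:
  assumes "infinite Z"
  shows "\<exists>p :: nat \<Rightarrow> nat. (\<forall>i. p i \<in> Z \<and> d \<le> p i \<and> p i + d < p (Suc i)) \<and>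
    (\<forall>i j k l. i < j \<longrightarrow> k < l \<longrightarrow> subsequence \<sigma> (p i) (p j) \<simeq> subsequence \<sigma> (p k) (p l))"
proof -
  obtain h :: "'a list \<Rightarrow> nat" where h: "finite (range h)" "\<And>u v. h u = h v \<Longrightarrow> u \<simeq> v"
    using leq_finite_index by blast
  obtain s where s: "\<And>u. h u < s"
    using h(1) by (meson finite_nat_set_iff_bounded rangeI)
  define f where "f A = h (subsequence \<sigma> (Min A) (Max A))" for A
  obtain Y c where Y: "Y \<subseteq> Z" "infinite Y" and c: "\<And>x y. x \<in> Y \<Longrightarrow> y \<in> Y \<Longrightarrow> x \<noteq> y \<Longrightarrow> f {x, y} = c"
  proof -
    have "\<forall>x\<in>Z. \<forall>y\<in>Z. x \<noteq> y \<longrightarrow> f {x, y} < s" by (simp add: f_def s)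
    from Ramsey2[OF assms this] show ?thesis using that by metis
  qed
  \<comment> \<open>Only every \<open>Suc d\<close>-th element of the homogeneous set is kept, so
    consecutive cuts are more than \<open>d\<close> apart; starting at index \<open>Suc d\<close>
    rather than 0 gives \<open>d \<le> p 0\<close>.\<close>
  define p where "p i = enumerate Y (Suc i * Suc d)" for i
  have e: "enumerate Y a + b \<le> enumerate Y (a + b)" for a b
  proof (induction b)
    case (Suc b)
    have "enumerate Y (a + b) < enumerate Y (a + Suc b)"
      unfolding add_Suc_right using Y(2) by (rule enumerate_step)
    with Suc show ?case by linarith
  qed simp
  have pY: "p i \<in> Y" for i unfolding p_def by (rule enumerate_in_set[OF Y(2)])
  have step: "p i + d < p (Suc i)" for i
  proof -
    have "p (Suc i) = enumerate Y (Suc i * Suc d + Suc d)"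
      unfolding p_def by (simp only: mult_Suc[of "Suc i"] add.commute)
    then show ?thesis using e[of "Suc i * Suc d" "Suc d"] by (simp only: p_def)
  qed
  have less: "p i < p j" if "i < j" for i j
    using add_lessD1[OF step] that by (rule lift_Suc_mono_less)
  have "h (subsequence \<sigma> (p i) (p j)) = c" if "i < j" for i j
    using c[OF pY pY, of i j] less[OF that] by (simp add: f_def)
  moreover have "d \<le> p i" for i
  proof -
    have "d \<le> Suc i * Suc d" by simp
    also have "\<dots> \<le> p i" unfolding p_def by (rule le_enumerate[OF Y(2)])
    finally show ?thesis .
  qed
  ultimately show ?thesis
    using pY Y(1) step h(2) by (intro exI[of _ p]) auto
qed

text \<open>
  Modulo \<open>\<simeq>\<close>, the word \<open>s\<close> is right invertible in the finite monoid \<open>f S f\<close>, so some power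
  of it is the identity \<open>f\<close> of that monoid.
\<close>

lemma power_leq_left_identity:
  assumes sf: "s @ f \<simeq> s" and sz: "s @ z \<simeq> f"
  obtains n where "n > 0" and "list_power s n \<simeq> f"
proof -
  obtain h :: "'a list \<Rightarrow> nat" where h: "finite (range h)" "\<And>u v. h u = h v \<Longrightarrow> u \<simeq> v"
    using leq_finite_index by blast
  have "\<not> inj_on (\<lambda>n. h (list_power s (Suc n))) UNIV"
  proof
    assume "inj (\<lambda>n. h (list_power s (Suc n)))"
    then have "infinite (range (\<lambda>n. h (list_power s (Suc n))))"
      by (rule range_inj_infinite)
    moreover have "range (\<lambda>n. h (list_power s (Suc n))) \<subseteq> range h" by blast
    ultimately show False using h(1) finite_subset by blast
  qed
  then obtain i' j' where "i' \<noteq> j'" "h (list_power s (Suc i')) = h (list_power s (Suc j'))"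
    unfolding inj_on_def by blast
  then obtain i j where ij: "i < j" and eq: "list_power s (Suc i) \<simeq> list_power s (Suc j)"
    using h(2)[of "list_power s (Suc i')" "list_power s (Suc j')"] leq_sym
    by (cases "i' < j'") (blast, metis linorder_neqE_nat)
  \<comment> \<open>The innermost \<open>s @ z\<close> becomes \<open>f\<close>, which is absorbed
    by the \<open>s\<close> before it.\<close>
  have inv: "list_power s (Suc n) @ list_power z (Suc n) \<simeq> f" for n
  proof (induction n)
    case 0
    then show ?case using sz by simp
  next
    case (Suc n)
    have split: "list_power s (Suc (Suc n)) = list_power s n @ s @ s"
      using list_power_add[of s n "Suc (Suc 0)"] by simp
    have split': "list_power s (Suc n) = list_power s n @ s"
      using list_power_add[of s n "Suc 0"] by simp
    have "list_power s (Suc (Suc n)) @ list_power z (Suc (Suc n)) =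
        list_power s n @ (s @ (s @ z)) @ list_power z (Suc n)"
      unfolding split by simp
    also have "\<dots> \<simeq> list_power s n @ s @ list_power z (Suc n)"
      using leq_trans[OF leq_append[OF leq_refl sz] sf] leq_refl by (intro leq_append)
    also have "\<dots> = list_power s (Suc n) @ list_power z (Suc n)"
      unfolding split' by simp
    also note Suc
    finally show ?case .
  qed
  have pow: "list_power s (Suc n) @ f \<simeq> list_power s (Suc n)" for n
  proof -
    have split: "list_power s (Suc n) = list_power s n @ s"
      using list_power_add[of s n "Suc 0"] by simp
    show ?thesis unfolding split using leq_append[OF leq_refl sf] by simp
  qed
  have j: "Suc j = Suc (j - Suc i) + Suc i" using ij by simp
  \<comment> \<open>Two equivalent powers of \<open>s\<close> are multiplied by
    \<open>list_power z (Suc i)\<close>, which cancels \<open>Suc i\<close> factors and leaves the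
    power \<open>j - i\<close>.\<close>
  have "f \<simeq> list_power s (Suc i) @ list_power z (Suc i)" using inv by (rule leq_sym)
  also have "\<dots> \<simeq> list_power s (Suc j) @ list_power z (Suc i)"
    using eq leq_refl by (rule leq_append)
  also have "\<dots> = list_power s (Suc (j - Suc i)) @ (list_power s (Suc i) @ list_power z (Suc i))"
    by (subst j, subst list_power_add) simp
  also have "\<dots> \<simeq> list_power s (Suc (j - Suc i)) @ f"
    using leq_refl inv by (rule leq_append)
  also note pow
  finally show ?thesis using that leq_sym by blast
qed

text \<open>Ramsey cuts at occurrences of \<open>t\<close> give a prefix \<open>s\<close> followed
  by segments in one idempotent class \<open>w\<close>. Both begin with \<open>t\<close> and lie in
  \<open>F\<close>, so minimality leads from each of them back to \<open>t\<close>.\<close>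

lemma weq_left_identity_iter:
  assumes t: "t \<noteq> []" and min: "right_minimal F t"
    and start: "subsequence \<sigma> 0 (length t) = t"
    and inf: "infinite {i. subsequence \<sigma> i (i + length t) = t}"
    and F: "\<And>i j. i < j \<Longrightarrow> subsequence \<sigma> i j \<in> F"
  obtains w x where "w = t @ x" and "w @ t \<simeq> t" and "weq \<sigma> (w\<^sup>\<omega>)"
proof -
  let ?d = "length t"
  obtain p where pZ: "\<And>i. p i \<in> {i. subsequence \<sigma> i (i + ?d) = t}" and p0: "\<And>i. ?d \<le> p i"
    and step: "\<And>i. p i + ?d < p (Suc i)"
    and hom: "\<And>i j k l. i < j \<Longrightarrow> k < l \<Longrightarrow> subsequence \<sigma> (p i) (p j) \<simeq> subsequence \<sigma> (p k) (p l)"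
    using ramsey_factorization[OF inf, of ?d \<sigma>] by metis
  have occ: "subsequence \<sigma> (p i) (p i + ?d) = t" for i using pZ[of i] by simp
  have join: "subsequence \<sigma> i j @ subsequence \<sigma> j k = subsequence \<sigma> i k" if "i \<le> j" "j \<le> k" for i j k
  proof -
    have "[i..<k] = [i..<j] @ [j..<k]" using upt_add_eq_append[of i j "k - j"] that by simp
    then show ?thesis by (simp add: subsequence_def)
  qed
  have less: "p i < p (Suc i)" for i using step[of i] by simp
  define w where "w = subsequence \<sigma> (p 0) (p 1)"
  have pd: "p 0 + ?d \<le> p 1" using step[of 0] by simp
  have ww: "w @ w \<simeq> w"
  proof -
    have "w @ w \<simeq> subsequence \<sigma> (p 0) (p 1) @ subsequence \<sigma> (p 1) (p 2)"
      unfolding w_def by (rule leq_append) (auto intro: hom leq_refl)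
    also have "\<dots> = subsequence \<sigma> (p 0) (p 2)"
      using less[of 0] less[of 1] by (intro join) (simp_all add: numeral_2_eq_2)
    also have "\<dots> \<simeq> w" unfolding w_def by (rule hom) auto
    finally show ?thesis .
  qed
  obtain x where x: "w = t @ x"
    using join[of "p 0" "p 0 + ?d" "p 1"] pd occ[of 0] by (metis le_add1 w_def)
  have "w \<in> F" unfolding w_def using less[of 0] by (intro F) simp
  then obtain y where y: "w @ y \<simeq> t"
    using min x by (auto simp: right_minimal_def)
  \<comment> \<open>An idempotent is a left identity on its right ideal, and \<open>t\<close> lies
    in that of \<open>w\<close>.\<close>
  have wt: "w @ t \<simeq> t"
  proof -
    have "w @ t \<simeq> w @ w @ y" using leq_refl leq_sym[OF y] by (rule leq_append)
    also have "\<dots> \<simeq> w @ y" using leq_append[OF ww leq_refl] by simp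
    also note y
    finally show ?thesis .
  qed
  \<comment> \<open>Absorbing the prefix: \<open>s\<close> is unchanged by \<open>w\<close> on the
    right and can be continued to \<open>w\<close>, so a power of \<open>s\<close> is equivalent to
    \<open>w\<close>. Hence \<open>s\<close> followed by \<open>w\<^sup>\<omega>\<close> is
    equivalent to \<open>s\<^sup>\<omega>\<close> and so to \<open>w\<^sup>\<omega>\<close>.\<close>
  define s where "s = subsequence \<sigma> 0 (p 1)"
  have s_split: "s = subsequence \<sigma> 0 (p 0) @ w"
    unfolding s_def w_def using less[of 0] by (simp add: join)
  have sw: "s @ w \<simeq> s" unfolding s_split using leq_append[OF leq_refl ww] by simp
  obtain x' where x': "s = t @ x'"
    using join[of 0 ?d "p 1"] p0[of 1] start by (metis le0 s_def)
  have "s \<in> F" unfolding s_def using less[of 0] by (intro F) simp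
  then obtain y' where "s @ y' \<simeq> t"
    using min x' by (auto simp: right_minimal_def)
  then have "s @ (y' @ x) \<simeq> w"
    using leq_append[OF _ leq_refl] x by fastforce
  then obtain n where n: "n > 0" "list_power s n \<simeq> w"
    using power_leq_left_identity[OF sw] by blast
  have s_ne: "s \<noteq> []" and w_ne: "w \<noteq> []" using x x' t by auto
  have pow_ne: "list_power s n \<noteq> []" using n s_ne by (cases n) auto
  have tail: "weq (suffix (p 1) \<sigma>) (w\<^sup>\<omega>)"
  proof (rule weq_factorization[of "\<lambda>i. p (Suc i) - p 1" "\<lambda>i. i * length w"])
    have mono: "p 1 \<le> p (Suc i)" for i
      by (induction i) (use less le_less_trans less_imp_le in \<open>auto, blast\<close>)
    show "idx_sequence (\<lambda>i. p (Suc i) - p 1)"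
      using less mono by (auto simp: idx_sequence_def intro: diff_less_mono)
    show "idx_sequence (\<lambda>i. i * length w)" using w_ne by (simp add: idx_sequence_def)
    show "subsequence (suffix (p 1) \<sigma>) (p (Suc i) - p 1) (p (Suc (Suc i)) - p 1) \<simeq>
        subsequence (w\<^sup>\<omega>) (i * length w) (Suc i * length w)" for i
    proof -
      have "subsequence (w\<^sup>\<omega>) (i * length w) (Suc i * length w) = w"
        using w_ne by (intro nth_equalityI) simp_all
      moreover have "subsequence \<sigma> (p (Suc i)) (p (Suc (Suc i))) \<simeq> w"
        unfolding w_def by (rule hom) auto
      ultimately show ?thesis using mono[of i] mono[of "Suc i"] by simp
    qed
  qed
  have "weq \<sigma> (s \<frown> w\<^sup>\<omega>)"
    using weq_conc[OF leq_refl[of s] tail] by (simp add: s_def)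
  also have "weq \<dots> (s \<frown> (list_power s n)\<^sup>\<omega>)"
    using leq_refl by (rule weq_conc) (rule weq_iter[OF w_ne pow_ne leq_sym[OF n(2)]])
  also have "s \<frown> (list_power s n)\<^sup>\<omega> = (list_power s n)\<^sup>\<omega>"
    using iter_list_power[OF s_ne n(1)] iter_unroll[of s] s_ne by simp
  also have "weq \<dots> (w\<^sup>\<omega>)" using pow_ne w_ne n(2) by (rule weq_iter)
  finally show ?thesis using that[OF x wt] by blast
qed

text \<open>The idempotents \<open>w\<close> and \<open>v\<close> of the two words are left
  identities for each other, which makes \<open>w\<^sup>\<omega>\<close>,
  \<open>(v @ w)\<^sup>\<omega>\<close>, \<open>v \<frown> (w @ v)\<^sup>\<omega>\<close> and
  \<open>v\<^sup>\<omega>\<close> equivalent.\<close>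

lemma weq_of_right_minimal:
  assumes t: "t \<noteq> []" and min: "right_minimal F t"
    and \<sigma>: "subsequence \<sigma> 0 (length t) = t" "infinite {i. subsequence \<sigma> i (i + length t) = t}" "\<And>i j. i < j \<Longrightarrow> subsequence \<sigma> i j \<in> F"
    and \<tau>: "subsequence \<tau> 0 (length t) = t" "infinite {i. subsequence \<tau> i (i + length t) = t}" "\<And>i j. i < j \<Longrightarrow> subsequence \<tau> i j \<in> F"
  shows "weq \<sigma> \<tau>"
proof -
  obtain w x where w: "w = t @ x" "w @ t \<simeq> t" "weq \<sigma> (w\<^sup>\<omega>)"
    using weq_left_identity_iter[OF t min \<sigma>] by blast
  obtain v y where v: "v = t @ y" "v @ t \<simeq> t" "weq \<tau> (v\<^sup>\<omega>)"
    using weq_left_identity_iter[OF t min \<tau>] by blast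
  have ne: "w \<noteq> []" "v \<noteq> []" using t w(1) v(1) by auto
  have vw: "v @ w \<simeq> w" unfolding w(1) using leq_append[OF v(2) leq_refl] by simp
  have wv: "w @ v \<simeq> v" unfolding v(1) using leq_append[OF w(2) leq_refl] by simp
  note w(3)
  also have "weq (w\<^sup>\<omega>) ((v @ w)\<^sup>\<omega>)" using ne vw by (intro weq_iter) (auto intro: leq_sym)
  also have "(v @ w)\<^sup>\<omega> = v \<frown> (w @ v)\<^sup>\<omega>" using ne by (intro iter_append) simp
  also have "weq \<dots> (v \<frown> v\<^sup>\<omega>)"
    using leq_refl by (rule weq_conc) (use ne wv in \<open>auto intro: weq_iter\<close>)
  also have "v \<frown> v\<^sup>\<omega> = v\<^sup>\<omega>" using ne iter_unroll[of v] by simp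
  also have "weq \<dots> \<tau>" using v(3) by (rule weq_sym)
  finally show ?thesis .
qed

end

section \<open>Games on words\<close>

definition word_game :: "nat \<Rightarrow> nat \<Rightarrow> int set \<Rightarrow> biword \<Rightarrow> int set \<Rightarrow> biword \<Rightarrow> bool" where
  "word_game m k I \<xi> J \<eta> \<longleftrightarrow>
    mso_game m k I (\<lambda>i. if i = 0 then {n. \<xi> n} else {}) J (\<lambda>i. if i = 0 then {n. \<eta> n} else {})"

lemma word_game_refl: "word_game m k I \<xi> I \<xi>"
  unfolding word_game_def by (rule mso_game_refl)

lemma word_game_sym: "word_game m k I \<xi> J \<eta> \<Longrightarrow> word_game m k J \<eta> I \<xi>"
  unfolding word_game_def by (rule mso_game_sym)

lemma word_game_trans [trans]:
  "word_game m k I \<xi> J \<eta> \<Longrightarrow> word_game m k J \<eta> K \<zeta> \<Longrightarrow> word_game m k I \<xi> K \<zeta>"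
  unfolding word_game_def by (rule mso_game_trans)

lemma word_game_shift:
  assumes "J = (\<lambda>n. n + c) ` I" and "\<And>n. n \<in> I \<Longrightarrow> \<eta> (n + c) = \<xi> n"
  shows "word_game m k I \<xi> J \<eta>"
  unfolding word_game_def
  by (rule mso_game_iso[of "\<lambda>n. n + c"])
    (use assms in \<open>auto simp: bij_betw_def inj_on_def intro: strict_mono_onI\<close>)

lemma word_game_sum:
  fixes A B :: "'i::linorder \<Rightarrow> int set"
  assumes "\<And>c d x y. c < d \<Longrightarrow> x \<in> A c \<Longrightarrow> y \<in> A d \<Longrightarrow> x < y"
    and "\<And>c d x y. c < d \<Longrightarrow> x \<in> B c \<Longrightarrow> y \<in> B d \<Longrightarrow> x < y"
    and "\<And>c. word_game m k (A c) \<xi> (B c) \<eta>"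
  shows "word_game m k (\<Union>c. A c) \<xi> (\<Union>c. B c) \<eta>"
  using assms unfolding word_game_def by (rule mso_game_sum)

lemma word_game_Un:
  assumes "\<And>x y. x \<in> I \<Longrightarrow> y \<in> I' \<Longrightarrow> x < y" and "\<And>x y. x \<in> J \<Longrightarrow> y \<in> J' \<Longrightarrow> x < y"
    and "word_game m k I \<xi> J \<eta>" and "word_game m k I' \<xi> J' \<eta>"
  shows "word_game m k (I \<union> I') \<xi> (J \<union> J') \<eta>"
  using assms unfolding word_game_def by (rule mso_game_Un)

lemma word_game_reflect:
  assumes "word_game m k I \<xi> J \<eta>"
  shows "word_game m k (uminus ` I) (\<lambda>n. \<xi> (- n)) (uminus ` J) (\<lambda>n. \<eta> (- n))"
proof -
  have neg: "uminus ` {n. \<zeta> n} = {n. \<zeta> (- n)}" for \<zeta> :: biword by force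
  have "(\<lambda>i :: nat. uminus ` (if i = 0 then {n. \<zeta> n} else {})) =
      (\<lambda>i. if i = 0 then {n. \<zeta> (- n)} else {})" for \<zeta> :: biword
    by (rule ext) (simp add: neg)
  then show ?thesis
    using mso_game_reflect[OF assms[unfolded word_game_def]] by (simp add: word_game_def)
qed

lemma mso_equiv_of_word_game:
  assumes "\<And>m k. word_game m k UNIV \<xi> UNIV \<eta>"
  shows "mso_equiv \<xi> \<eta>"
  unfolding mso_equiv_def models_def
proof (intro allI impI)
  fix \<phi> assume "sentence \<phi>"
  then have enc: "encodes \<phi> (\<zeta> -` {True}) v V (\<lambda>i. if i = 0 then {n. \<zeta> n} else {})" for \<zeta> v V
    by (auto simp: encodes_def sentence_def)
  obtain m where "slots \<phi> \<subseteq> {..<m}"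
    using finite_slots finite_nat_bounded by blast
  then have "sat (\<xi> -` {True}) v V \<phi> \<longleftrightarrow> sat (\<eta> -` {True}) v V \<phi>" for v V
    using assms[of m "quantifier_rank \<phi>"] unfolding word_game_def
    by (rule sat_mso_game[OF _ _ enc enc, rotated])
  then show "(\<forall>v V. sat (\<xi> -` {True}) v V \<phi>) \<longleftrightarrow> (\<forall>v V. sat (\<eta> -` {True}) v V \<phi>)"
    by simp
qed

text \<open>Outside the interval the values of \<open>u ! nat n\<close> mean nothing; the game sees
  only traces on the interval.\<close>

definition list_game :: "nat \<Rightarrow> nat \<Rightarrow> bool list \<Rightarrow> bool list \<Rightarrow> bool" where
  "list_game m k u v \<longleftrightarrow>
    word_game m k {0..<int (length u)} (\<lambda>n. u ! nat n) {0..<int (length v)} (\<lambda>n. v ! nat n)"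

definition omega_game :: "nat \<Rightarrow> nat \<Rightarrow> bool word \<Rightarrow> bool word \<Rightarrow> bool" where
  "omega_game m k \<sigma> \<tau> \<longleftrightarrow> word_game m k {0..} (\<lambda>n. \<sigma> (nat n)) {0..} (\<lambda>n. \<tau> (nat n))"

lemma shift_image_ivl:
  "(\<lambda>n. n + c) ` {a..<b} = {a + c..<b + c}" "(\<lambda>n. n + c) ` {a..} = {a + c..}"
  for a b c :: int
proof -
  have "x \<in> (\<lambda>n. n + c) ` S \<longleftrightarrow> x - c \<in> S" for x S by force
  then show "(\<lambda>n. n + c) ` {a..<b} = {a + c..<b + c}" "(\<lambda>n. n + c) ` {a..} = {a + c..}"
    by auto
qed

lemma word_game_list:
  assumes "b = a + int (length u)" and "\<And>i. i < length u \<Longrightarrow> \<xi> (a + int i) = u ! i"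
  shows "word_game m k {a..<b} \<xi> {0..<int (length u)} (\<lambda>n. u ! nat n)"
proof (rule word_game_shift[of _ "- a"])
  show "{0..<int (length u)} = (\<lambda>n. n + - a) ` {a..<b}"
    unfolding shift_image_ivl using assms(1) by simp
  show "u ! nat (n + - a) = \<xi> n" if "n \<in> {a..<b}" for n
  proof -
    have "nat (n - a) < length u" using that assms(1) by (auto simp: nat_less_iff)
    from assms(2)[OF this] show ?thesis using that by simp
  qed
qed

lemma list_game_segments:
  assumes "b = a + int (length u)" and "\<And>i. i < length u \<Longrightarrow> \<xi> (a + int i) = u ! i"
    and "b' = a' + int (length v)" and "\<And>i. i < length v \<Longrightarrow> \<eta> (a' + int i) = v ! i"
    and "list_game m k u v"
  shows "word_game m k {a..<b} \<xi> {a'..<b'} \<eta>"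
  using word_game_list[OF assms(1,2)] assms(5)[unfolded list_game_def]
    word_game_list[OF assms(3,4), THEN word_game_sym]
  by (blast intro: word_game_trans)

text \<open>Concatenation is an ordered sum of two structures and an infinite factorization is one
  over the naturals, so both congruence properties are instances of composition. Finite index is
  inherited from the games.\<close>

lemma omega_congruence_games: "omega_congruence (list_game m k) (omega_game m k)"
proof
  show "list_game m k u u" for u
    unfolding list_game_def by (rule word_game_refl)
  show "list_game m k u v \<Longrightarrow> list_game m k v u" for u v
    unfolding list_game_def by (rule word_game_sym)
  show "list_game m k u v \<Longrightarrow> list_game m k v w \<Longrightarrow> list_game m k u w" for u v w
    unfolding list_game_def by (rule word_game_trans)
  show "omega_game m k \<sigma> \<tau> \<Longrightarrow> omega_game m k \<tau> \<sigma>" for \<sigma> \<tau>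
    unfolding omega_game_def by (rule word_game_sym)
  show "omega_game m k \<sigma> \<tau> \<Longrightarrow> omega_game m k \<tau> \<rho> \<Longrightarrow> omega_game m k \<sigma> \<rho>" for \<sigma> \<tau> \<rho>
    unfolding omega_game_def by (rule word_game_trans)
next
  fix u u' v v' assume *: "list_game m k u u'" "list_game m k v v'"
  let ?l = "int (length u)" and ?l' = "int (length u')"
  let ?n = "int (length (u @ v))" and ?n' = "int (length (u' @ v'))"
  have "word_game m k ({0..<?l} \<union> {?l..<?n}) (\<lambda>n. (u @ v) ! nat n)
      ({0..<?l'} \<union> {?l'..<?n'}) (\<lambda>n. (u' @ v') ! nat n)"
  proof (rule word_game_Un)
    show "word_game m k {0..<?l} (\<lambda>n. (u @ v) ! nat n) {0..<?l'} (\<lambda>n. (u' @ v') ! nat n)"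
      by (rule list_game_segments[OF _ _ _ _ *(1)]) (auto simp: nth_append)
    show "word_game m k {?l..<?n} (\<lambda>n. (u @ v) ! nat n) {?l'..<?n'} (\<lambda>n. (u' @ v') ! nat n)"
      by (rule list_game_segments[OF _ _ _ _ *(2)]) (auto simp: nth_append nat_add_distrib)
  qed auto
  moreover have "{0..<?l} \<union> {?l..<?n} = {0..<?n}" "{0..<?l'} \<union> {?l'..<?n'} = {0..<?n'}"
    by auto
  ultimately show "list_game m k (u @ v) (u' @ v')" unfolding list_game_def by simp
next
  obtain h :: "int set \<times> (nat \<Rightarrow> int set) \<Rightarrow> nat" where "finite (range h)"
    and h: "\<And>I V J W. h (I, V) = h (J, W) \<Longrightarrow> mso_game m k I V J W"
    using mso_game_finite_index by blast
  define g where "g u = h ({0..<int (length u)}, \<lambda>i. if i = 0 then {n. u ! nat n} else {})" for u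
  have "range g \<subseteq> range h" unfolding g_def by blast
  then have "finite (range g)" using \<open>finite (range h)\<close> by (rule finite_subset)
  moreover have "list_game m k u v" if "g u = g v" for u v
    using that h unfolding g_def list_game_def word_game_def by blast
  ultimately show "\<exists>g :: bool list \<Rightarrow> nat. finite (range g) \<and> (\<forall>u v. g u = g v \<longrightarrow> list_game m k u v)"
    by blast
next
  fix u v and \<sigma> \<tau> :: "bool word" assume *: "list_game m k u v" "omega_game m k \<sigma> \<tau>"
  let ?l = "int (length u)" and ?l' = "int (length v)"
  have tail: "word_game m k {int (length w)..} (\<lambda>n. (w \<frown> \<rho>) (nat n)) {0..} (\<lambda>n. \<rho> (nat n))" for w \<rho>
  proof (rule word_game_shift[of _ "- int (length w)"])
    show "{0..} = (\<lambda>n. n + - int (length w)) ` {int (length w)..}"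
      unfolding shift_image_ivl by simp
    show "\<rho> (nat (n + - int (length w))) = (w \<frown> \<rho>) (nat n)" if "n \<in> {int (length w)..}" for n
    proof -
      have "\<not> nat n < length w" "nat (n + - int (length w)) = nat n - length w"
        using that by auto
      then show ?thesis by simp
    qed
  qed
  have "word_game m k ({0..<?l} \<union> {?l..}) (\<lambda>n. (u \<frown> \<sigma>) (nat n))
      ({0..<?l'} \<union> {?l'..}) (\<lambda>n. (v \<frown> \<tau>) (nat n))"
  proof (rule word_game_Un)
    show "word_game m k {0..<?l} (\<lambda>n. (u \<frown> \<sigma>) (nat n)) {0..<?l'} (\<lambda>n. (v \<frown> \<tau>) (nat n))"
      by (rule list_game_segments[OF _ _ _ _ *(1)]) auto
    show "word_game m k {?l..} (\<lambda>n. (u \<frown> \<sigma>) (nat n)) {?l'..} (\<lambda>n. (v \<frown> \<tau>) (nat n))"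
      using word_game_trans[OF tail word_game_trans[OF *(2)[unfolded omega_game_def]
            word_game_sym[OF tail]]] .
  qed auto
  moreover have "{0..<?l} \<union> {?l..} = {0..}" "{0..<?l'} \<union> {?l'..} = {0..}" by auto
  ultimately show "omega_game m k (u \<frown> \<sigma>) (v \<frown> \<tau>)" unfolding omega_game_def by simp
next
  fix p q and \<sigma> \<tau> :: "bool word"
  assume p: "idx_sequence p" and q: "idx_sequence q"
    and *: "\<And>i. list_game m k (subsequence \<sigma> (p i) (p (Suc i))) (subsequence \<tau> (q i) (q (Suc i)))"
  have less: "x < y" if r: "idx_sequence r" and "c < d" "x \<in> {int (r c)..<int (r (Suc c))}"
      "y \<in> {int (r d)..<int (r (Suc d))}" for r c d x y
    using idx_sequence_mono[OF r, of "Suc c" d] that by auto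
  have cover: "(\<Union>c. {int (r c)..<int (r (Suc c))}) = {0..}" if r: "idx_sequence r" for r
  proof
    show "{0..} \<subseteq> (\<Union>c. {int (r c)..<int (r (Suc c))})"
    proof
      fix x :: int assume "x \<in> {0..}"
      then show "x \<in> (\<Union>c. {int (r c)..<int (r (Suc c))})"
        using idx_sequence_interval[OF r, of "nat x"] by (auto simp: nat_less_iff le_nat_iff)
    qed
  qed auto
  have "word_game m k (\<Union>c. {int (p c)..<int (p (Suc c))}) (\<lambda>n. \<sigma> (nat n))
      (\<Union>c. {int (q c)..<int (q (Suc c))}) (\<lambda>n. \<tau> (nat n))"
  proof (rule word_game_sum)
    fix c
    have "p c < p (Suc c)" "q c < q (Suc c)" using p q by (auto simp: idx_sequence_def)
    then show "word_game m k {int (p c)..<int (p (Suc c))} (\<lambda>n. \<sigma> (nat n))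
        {int (q c)..<int (q (Suc c))} (\<lambda>n. \<tau> (nat n))"
      by (intro list_game_segments[OF _ _ _ _ *[of c]]) (auto simp: nat_add_distrib)
  qed (use less p q in blast)+
  then show "omega_game m k \<sigma> \<tau>" unfolding cover[OF p] cover[OF q] omega_game_def .
qed

section \<open>Recurrent words with the same factors\<close>

text \<open>Start and length replace the two end points of \<open>factors_on\<close>, so the empty
  word needs no separate case.\<close>

definition segment :: "biword \<Rightarrow> int \<Rightarrow> nat \<Rightarrow> bool list" where
  "segment \<xi> p n = map (\<lambda>i. \<xi> (p + int i)) [0..<n]"

definition language :: "biword \<Rightarrow> bool list set" where
  "language \<xi> = {segment \<xi> p n | p n. True}"

lemma length_segment [simp]: "length (segment \<xi> p n) = n"
  by (simp add: segment_def)

lemma segment_nth [simp]: "i < n \<Longrightarrow> segment \<xi> p n ! i = \<xi> (p + int i)"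
  by (simp add: segment_def)

lemma segment_eq_iff: "segment \<xi> p n = segment \<eta> q n \<longleftrightarrow> (\<forall>i<n. \<xi> (p + int i) = \<eta> (q + int i))"
  by (auto simp: list_eq_iff_nth_eq)

lemma segment_add: "segment \<xi> p (m + n) = segment \<xi> p m @ segment \<xi> (p + int m) n"
  by (rule nth_equalityI) (auto simp: nth_append algebra_simps of_nat_diff)

lemma segment_in_language: "segment \<xi> p n \<in> language \<xi>"
  by (auto simp: language_def)

lemma in_languageD: "t \<in> language \<xi> \<Longrightarrow> \<exists>p. segment \<xi> p (length t) = t"
  by (auto simp: language_def)

lemma segment_eq_map: "segment \<xi> k n = map \<xi> [k..k + int n - 1]"
  by (rule nth_equalityI) auto

lemma factors_on_eq:
  "factors_on I \<xi> = {segment \<xi> p n | p n. {p..p + int n - 1} \<subseteq> I}"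
proof -
  have "map \<xi> [k..l] \<in> {segment \<xi> p n | p n. {p..p + int n - 1} \<subseteq> I}"
    if "k \<le> l" "{k..l} \<subseteq> I" for k l
  proof -
    have "k + int (nat (l - k + 1)) - 1 = l" using that by simp
    with that show ?thesis
      by (intro CollectI exI[of _ k] exI[of _ "nat (l - k + 1)"]) (simp add: segment_eq_map)
  qed
  moreover have "[] \<in> {segment \<xi> p n | p n. {p..p + int n - 1} \<subseteq> I}"
    by (intro CollectI exI[of _ 0]) (simp add: segment_def)
  moreover have "segment \<xi> p n \<in> factors_on I \<xi>" if "{p..p + int n - 1} \<subseteq> I" for p n
  proof (cases "n = 0")
    case False
    then show ?thesis
      using that unfolding factors_on_def segment_eq_map
      by (intro UnI1 CollectI exI[of _ p] exI[of _ "p + int n - 1"]) simp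
  qed (simp add: factors_on_def segment_def)
  ultimately show ?thesis
    unfolding factors_on_def by blast
qed

lemma language_eq_factors: "language \<xi> = factors_on UNIV \<xi>"
  unfolding factors_on_eq language_def by simp

text \<open>Containment in a half-line becomes a bound on the starting position alone. On the left
  the start must be moved by the length of \<open>t\<close>, which is possible because
  \<open>i\<close> is arbitrary.\<close>

lemma recurrent_iff:
  "recurrent \<xi> \<longleftrightarrow> (\<forall>t\<in>language \<xi>. \<forall>i. (\<exists>q\<ge>i. segment \<xi> q (length t) = t) \<and>
     (\<exists>q\<le>i. segment \<xi> q (length t) = t))"
proof
  assume rec: "recurrent \<xi>"
  show "\<forall>t\<in>language \<xi>. \<forall>i. (\<exists>q\<ge>i. segment \<xi> q (length t) = t) \<and> (\<exists>q\<le>i. segment \<xi> q (length t) = t)"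
  proof (intro ballI allI)
    fix t i assume "t \<in> language \<xi>"
    show "(\<exists>q\<ge>i. segment \<xi> q (length t) = t) \<and> (\<exists>q\<le>i. segment \<xi> q (length t) = t)"
    \<comment> \<open>An empty interval lies in every half-line and says nothing about its
      start.\<close>
    proof (cases "t = []")
      case True
      then show ?thesis by (auto simp: segment_def)
    next
      case False
      have "t \<in> factors_on {..i} \<xi>" "t \<in> factors_on {i..} \<xi>"
        using rec \<open>t \<in> language \<xi>\<close> by (auto simp: recurrent_def language_eq_factors)
      moreover have "\<exists>p. {p..p + int (length t) - 1} \<subseteq> I \<and> segment \<xi> p (length t) = t"
        if fac: "t \<in> factors_on I \<xi>" for I
      proof -
        obtain p n where "t = segment \<xi> p n" "{p..p + int n - 1} \<subseteq> I"
          using fac unfolding factors_on_eq by blast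
        then show ?thesis by (metis length_segment)
      qed
      ultimately obtain p q where "{p..p + int (length t) - 1} \<subseteq> {..i}" "segment \<xi> p (length t) = t"
          "{q..q + int (length t) - 1} \<subseteq> {i..}" "segment \<xi> q (length t) = t"
        by meson
      moreover have "length t > 0" using False by simp
      moreover from this have "p \<in> {p..p + int (length t) - 1}" "q \<in> {q..q + int (length t) - 1}"
        by auto
      ultimately have "p \<le> i" "q \<ge> i" by blast+
      then show ?thesis using \<open>segment \<xi> p (length t) = t\<close> \<open>segment \<xi> q (length t) = t\<close> by blast
    qed
  qed
next
  assume rec: "\<forall>t\<in>language \<xi>. \<forall>i. (\<exists>q\<ge>i. segment \<xi> q (length t) = t) \<and>
     (\<exists>q\<le>i. segment \<xi> q (length t) = t)"
  have "t \<in> factors_on {..i} \<xi>" "t \<in> factors_on {i..} \<xi>" if t: "t \<in> language \<xi>" for t i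
  proof -
    obtain p where "p \<le> i - int (length t)" "segment \<xi> p (length t) = t" using rec t by blast
    moreover from this have "{p..p + int (length t) - 1} \<subseteq> {..i}" by auto
    ultimately show "t \<in> factors_on {..i} \<xi>"
      unfolding factors_on_eq by (intro CollectI exI[of _ p] exI[of _ "length t"]) simp
    obtain q where "q \<ge> i" "segment \<xi> q (length t) = t" using rec t by blast
    moreover from this have "{q..q + int (length t) - 1} \<subseteq> {i..}" by auto
    ultimately show "t \<in> factors_on {i..} \<xi>"
      unfolding factors_on_eq by (intro CollectI exI[of _ q] exI[of _ "length t"]) simp
  qed
  moreover have "factors_on I \<xi> \<subseteq> language \<xi>" for I
    unfolding factors_on_eq language_def by blast
  ultimately show "recurrent \<xi>"
    unfolding recurrent_def language_eq_factors[symmetric] by blast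
qed

lemma segment_reflect: "rev (segment \<xi> p n) = segment (\<lambda>i. \<xi> (- i)) (- (p + int n - 1)) n"
  by (rule nth_equalityI) (auto simp: rev_nth of_nat_diff algebra_simps)

lemma segment_reflect': "segment (\<lambda>i. \<xi> (- i)) p n = rev (segment \<xi> (- (p + int n - 1)) n)"
  by (simp add: segment_reflect)

lemma language_reflect: "language (\<lambda>i. \<xi> (- i)) = rev ` language \<xi>"
proof
  show "language (\<lambda>i. \<xi> (- i)) \<subseteq> rev ` language \<xi>"
    unfolding language_def[of "\<lambda>i. \<xi> (- i)"] by (auto simp: segment_reflect' segment_in_language)
  show "rev ` language \<xi> \<subseteq> language (\<lambda>i. \<xi> (- i))"
    unfolding language_def[of \<xi>] by (auto simp: segment_reflect segment_in_language)
qed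

text \<open>The positional form of \<open>weq_of_right_minimal\<close>: it is applied to the
  omega-words read from \<open>p\<close> and from \<open>q\<close>, and recurrence to the right
  supplies the infinitely many occurrences of \<open>t\<close>.\<close>

lemma word_game_right_half:
  assumes "t \<noteq> []"
    and "omega_congruence.right_minimal (list_game m k) F t"
    and "language \<xi> \<subseteq> F" "segment \<xi> p (length t) = t" "\<And>i. \<exists>j\<ge>i. segment \<xi> j (length t) = t"
    and "language \<eta> \<subseteq> F" "segment \<eta> q (length t) = t" "\<And>i. \<exists>j\<ge>i. segment \<eta> j (length t) = t"
  shows "word_game m k {p..} \<xi> {q..} \<eta>"
proof -
  interpret omega_congruence "list_game m k" "omega_game m k"
    by (rule omega_congruence_games)
  let ?tail = "\<lambda>(\<zeta> :: biword) a n. \<zeta> (a + int n)"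
  have seg: "subsequence (?tail \<zeta> a) i j = segment \<zeta> (a + int i) (j - i)" for \<zeta> a i j
    by (rule nth_equalityI) (auto simp: algebra_simps)
  have inf: "infinite {i. subsequence (?tail \<zeta> a) i (i + length t) = t}"
    if occ: "\<And>i. \<exists>j\<ge>i. segment \<zeta> j (length t) = t" for \<zeta> a
    unfolding infinite_nat_iff_unbounded_le
  proof
    fix l
    obtain j where j: "j \<ge> a + int l" "segment \<zeta> j (length t) = t" using occ by blast
    then have "a + int (nat (j - a)) = j" "l \<le> nat (j - a)" by auto
    with j show "\<exists>i\<ge>l. i \<in> {i. subsequence (?tail \<zeta> a) i (i + length t) = t}"
      by (intro exI[of _ "nat (j - a)"]) (simp add: seg)
  qed
  have half: "word_game m k {a..} \<zeta> {0..} (\<lambda>n. ?tail \<zeta> a (nat n))" for \<zeta> a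
    by (rule word_game_shift[of _ "- a"]) (simp_all only: shift_image_ivl, auto)
  have "omega_game m k (?tail \<xi> p) (?tail \<eta> q)"
  proof (rule weq_of_right_minimal[OF assms(1,2)])
    show "subsequence (?tail \<xi> p) 0 (length t) = t" "subsequence (?tail \<eta> q) 0 (length t) = t"
      using assms(4,7) by (simp_all add: seg)
    show "subsequence (?tail \<xi> p) i j \<in> F" "subsequence (?tail \<eta> q) i j \<in> F" for i j
      using assms(3,6) segment_in_language unfolding seg by blast+
  qed (use inf assms(5,8) in blast)+
  then show ?thesis
    using word_game_trans[OF half word_game_trans[OF _ word_game_sym[OF half]]]
    unfolding omega_game_def by blast
qed

text \<open>Both words contain a factor \<open>t\<close> that is minimal in both directions. The
  right halves from the start of \<open>t\<close> and the left halves up to its end are matched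
  separately; the overlap \<open>t\<close> lets a hybrid word mediate between them.\<close>

theorem recurrent_same_language_mso_equiv:
  assumes "recurrent \<xi>" and "recurrent \<eta>" and lang: "language \<eta> = language \<xi>"
  shows "mso_equiv \<xi> \<eta>"
proof (rule mso_equiv_of_word_game)
  fix m k
  interpret omega_congruence "list_game m k" "omega_game m k"
    by (rule omega_congruence_games)
  have occ: "\<exists>q\<ge>i. segment \<zeta> q (length t) = t" "\<exists>q\<le>i. segment \<zeta> q (length t) = t"
    if "t \<in> language \<xi>" "\<zeta> \<in> {\<xi>, \<eta>}" for t i \<zeta>
    using assms that unfolding recurrent_iff by blast+
  have "language \<xi> \<noteq> {}" using segment_in_language by blast
  then obtain u v where u: "u \<in> language \<xi>" "right_minimal (language \<xi>) u"
      and v: "v \<in> language \<xi>" "right_minimal (rev ` language \<xi>) (rev v)"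
    using ex_right_minimal[of "language \<xi>"] ex_right_minimal[of "rev ` language \<xi>"] by auto
  obtain p where p: "segment \<xi> p (length u) = u" using u(1) in_languageD by blast
  \<comment> \<open>The extra 1 keeps the final factor nonempty even if \<open>u\<close> and
    \<open>v\<close> are both empty.\<close>
  obtain p' where p': "p' \<ge> p + int (length u) + 1" "segment \<xi> p' (length v) = v"
    using occ(1)[OF v(1), of \<xi>] by blast
  define n where "n = nat (p' - p - int (length u))"
  have n: "n > 0" "p + int (length u) + int n = p'" using p'(1) by (simp_all add: n_def)
  \<comment> \<open>The stretch from \<open>u\<close> to \<open>v\<close> extends \<open>u\<close>
    to the right and, read backwards, extends \<open>rev v\<close>, so it inherits both
    minimalities.\<close>
  define t where "t = segment \<xi> p (length u + n + length v)"
  have t_split: "t = u @ segment \<xi> (p + int (length u)) n @ v"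
    unfolding t_def segment_add using p p'(2) n(2) by (simp add: add.assoc)
  have "t \<noteq> []" using n(1) unfolding t_split by (auto simp: segment_def)
  have t: "t \<in> language \<xi>" unfolding t_def by (rule segment_in_language)
  have min: "right_minimal (language \<xi>) t"
    unfolding t_split using u(2) by (rule right_minimal_append)
  have min': "right_minimal (rev ` language \<xi>) (rev t)"
    unfolding t_split rev_append append_assoc using v(2) by (rule right_minimal_append)
  obtain q where q: "segment \<eta> q (length t) = t" using occ(1)[OF t, of \<eta>] by blast
  have p: "segment \<xi> p (length t) = t" unfolding t_def by simp
  let ?l = "int (length t)"
  have right: "word_game m k {p..} \<xi> {q..} \<eta>"
    using \<open>t \<noteq> []\<close> min p q occ(1)[OF t] lang by (intro word_game_right_half) auto
  have left: "word_game m k {..p + ?l - 1} \<xi> {..q + ?l - 1} \<eta>"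
  proof -
    have refl: "segment (\<lambda>n. \<zeta> (- n)) (- (a + ?l - 1)) (length (rev t)) = rev t"
      if "segment \<zeta> a (length t) = t" for \<zeta> a
      using that by (simp add: segment_reflect')
    have inf: "\<exists>j\<ge>i. segment (\<lambda>n. \<zeta> (- n)) j (length (rev t)) = rev t" if "\<zeta> \<in> {\<xi>, \<eta>}" for \<zeta> i
    proof -
      obtain a where "a \<le> - i - ?l" "segment \<zeta> a (length t) = t" using occ(2)[OF t \<open>\<zeta> \<in> {\<xi>, \<eta>}\<close>] by blast
      with refl[of \<zeta> a] show ?thesis by (intro exI[of _ "- (a + ?l - 1)"]) simp
    qed
    have "word_game m k {- (p + ?l - 1)..} (\<lambda>n. \<xi> (- n)) {- (q + ?l - 1)..} (\<lambda>n. \<eta> (- n))"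
      using \<open>t \<noteq> []\<close> min' refl[OF p] refl[OF q] inf lang
      by (intro word_game_right_half[of "rev t"]) (auto simp: language_reflect)
    from word_game_reflect[OF this] show ?thesis by simp
  qed
  \<comment> \<open>The hybrid is \<open>\<xi>\<close> before \<open>p\<close> and
    \<open>\<eta>\<close> from its occurrence of \<open>t\<close> on. As both words read
    \<open>t\<close> there, it equals \<open>\<xi>\<close> up to the end of \<open>t\<close>; the
    right halves relate it to \<open>\<xi>\<close>, the left halves to
    \<open>\<eta>\<close>.\<close>
  define \<zeta> where "\<zeta> n = (if n < p then \<xi> n else \<eta> (n - p + q))" for n
  have mid: "\<zeta> n = \<xi> n" if "n \<le> p + ?l - 1" for n
  proof (cases "n < p")
    case False
    then have "nat (n - p) < length t" using that by auto
    then have "\<xi> (p + int (nat (n - p))) = \<eta> (q + int (nat (n - p)))"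
      using p q segment_nth by metis
    with False show ?thesis by (simp add: \<zeta>_def algebra_simps)
  qed (simp add: \<zeta>_def)
  have "word_game m k ({..<p} \<union> {p..}) \<xi> ({..<p} \<union> {p..}) \<zeta>"
  proof (rule word_game_Un)
    show "word_game m k {..<p} \<xi> {..<p} \<zeta>"
      by (rule word_game_shift[of _ 0]) (auto simp: \<zeta>_def)
    have "word_game m k {q..} \<eta> {p..} \<zeta>"
      by (rule word_game_shift[of _ "p - q"]) (auto simp: shift_image_ivl \<zeta>_def)
    with right show "word_game m k {p..} \<xi> {p..} \<zeta>" by (rule word_game_trans)
  qed auto
  moreover have "word_game m k ({..p + ?l - 1} \<union> {p + ?l..}) \<zeta> ({..q + ?l - 1} \<union> {q + ?l..}) \<eta>"
  proof (rule word_game_Un)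
    have "word_game m k {..p + ?l - 1} \<zeta> {..p + ?l - 1} \<xi>"
      by (rule word_game_shift[of _ 0]) (auto simp: mid)
    then show "word_game m k {..p + ?l - 1} \<zeta> {..q + ?l - 1} \<eta>" using left by (rule word_game_trans)
    show "word_game m k {p + ?l..} \<zeta> {q + ?l..} \<eta>"
      by (rule word_game_shift[of _ "q - p"]) (simp_all only: shift_image_ivl, auto simp: \<zeta>_def algebra_simps)
  qed auto
  moreover have "{..<a} \<union> {a..} = UNIV" "{..a - 1} \<union> {a..} = UNIV" for a :: int by auto
  ultimately show "word_game m k UNIV \<xi> UNIV \<eta>" using word_game_trans by simp
qed

section \<open>Definable positions\<close>

definition suc_fm :: "nat \<Rightarrow> nat \<Rightarrow> mso" where
  "suc_fm x y = Conj (Conj (Le x y) (Neg (Eq x y)))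
     (All1 (Suc (max x y)) (Disj (Le (Suc (max x y)) x) (Le y (Suc (max x y)))))"

primrec plus_fm :: "nat \<Rightarrow> nat \<Rightarrow> nat \<Rightarrow> mso" where
  "plus_fm 0 x y = Eq x y"
| "plus_fm (Suc n) x y =
     Ex1 (Suc (max x y)) (Conj (suc_fm x (Suc (max x y))) (plus_fm n (Suc (max x y)) y))"

definition letter_fm :: "bool \<Rightarrow> nat \<Rightarrow> mso" where
  "letter_fm b x = (if b then Pr x else Neg (Pr x))"

text \<open>\<open>Eq x x\<close> stands for truth. The last letter also asks for a successor
  position, which always exists among the integers.\<close>

primrec word_fm :: "bool list \<Rightarrow> nat \<Rightarrow> mso" where
  "word_fm [] x = Eq x x"
| "word_fm (b # t) x =
     Conj (letter_fm b x) (Ex1 (Suc x) (Conj (suc_fm x (Suc x)) (word_fm t (Suc x))))"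

lemma sat_suc_fm:
  fixes v :: "nat \<Rightarrow> int"
  shows "sat P v V (suc_fm x y) \<longleftrightarrow> v y = v x + 1"
proof -
  have "Suc (max x y) \<noteq> x" "Suc (max x y) \<noteq> y" by auto
  then have "sat P v V (suc_fm x y) \<longleftrightarrow> v x < v y \<and> (\<forall>a. a \<le> v x \<or> v y \<le> a)"
    by (auto simp: suc_fm_def)
  also have "\<dots> \<longleftrightarrow> v y = v x + 1"
    by (auto dest: spec[of _ "v x + 1"])
  finally show ?thesis .
qed

lemma sat_plus_fm:
  fixes v :: "nat \<Rightarrow> int"
  shows "sat P v V (plus_fm n x y) \<longleftrightarrow> v y = v x + int n"
proof (induction n arbitrary: x v)
  case (Suc n)
  have "x \<noteq> Suc (max x y)" "y \<noteq> Suc (max x y)" by auto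
  then show ?case by (simp add: Suc sat_suc_fm ac_simps)
qed auto

lemma sat_letter_fm: "sat P v V (letter_fm b x) \<longleftrightarrow> (v x \<in> P \<longleftrightarrow> b)"
  by (simp add: letter_fm_def)

lemma segment_Suc: "segment \<xi> p (Suc n) = \<xi> p # segment \<xi> (p + 1) n"
  using segment_add[of \<xi> p 1 n] by (simp add: segment_def)

lemma sat_word_fm:
  fixes v :: "nat \<Rightarrow> int"
  shows "sat (\<xi> -` {True}) v V (word_fm t x) \<longleftrightarrow> segment \<xi> (v x) (length t) = t"
  by (induction t arbitrary: x v)
    (auto simp: sat_letter_fm sat_suc_fm segment_Suc simp flip: length_0_conv)

lemma free1_fm:
  "free1 (suc_fm x y) \<subseteq> {x, y}" "free1 (letter_fm b x) = {x}"
  by (auto simp: suc_fm_def letter_fm_def)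

lemma free1_plus_fm: "free1 (plus_fm n x y) \<subseteq> {x, y}"
proof (induction n arbitrary: x)
  case (Suc n)
  from Suc[of "Suc (max x y)"] show ?case
    using free1_fm(1)[of x "Suc (max x y)"] by auto
qed simp

lemma free1_word_fm: "free1 (word_fm t x) \<subseteq> {x}"
proof (induction t arbitrary: x)
  case (Cons b t)
  from Cons[of "Suc x"] show ?case using free1_fm(1)[of x "Suc x"] by (auto simp: free1_fm(2))
qed simp

lemma free2_fm:
  "free2 (suc_fm x y) = {}" "free2 (plus_fm n x y) = {}" "free2 (letter_fm b x) = {}"
  "free2 (word_fm t x) = {}"
proof -
  show suc: "free2 (suc_fm x y) = {}" for x y by (simp add: suc_fm_def)
  show "free2 (plus_fm n x y) = {}" by (induction n arbitrary: x) (simp_all add: suc)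
  show letter: "free2 (letter_fm b x) = {}" for b x by (simp add: letter_fm_def)
  show "free2 (word_fm t x) = {}" by (induction t arbitrary: x) (simp_all add: suc letter)
qed

lemma mso_equiv_transfer:
  assumes "mso_equiv \<xi> \<eta>" and free: "free1 \<phi> \<subseteq> {0}" "free2 \<phi> = {}"
    and "sat (\<xi> -` {True}) (\<lambda>_. p) (\<lambda>_. {}) \<phi>"
  shows "\<exists>q. sat (\<eta> -` {True}) (\<lambda>_. q) (\<lambda>_. {}) \<phi>"
proof -
  have ex: "models \<zeta> (Ex1 0 \<phi>) \<longleftrightarrow> (\<exists>q. sat (\<zeta> -` {True}) (\<lambda>_. q) (\<lambda>_. {}) \<phi>)" for \<zeta>
  proof -
    have "sat (\<zeta> -` {True}) (v(0 := q)) V \<phi> \<longleftrightarrow> sat (\<zeta> -` {True}) (\<lambda>_. q) (\<lambda>_. {}) \<phi>" for v V q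
      by (rule sat_cong) (use free in auto)
    then show ?thesis by (simp add: models_def)
  qed
  have "sentence (Ex1 0 \<phi>)" using free by (auto simp: sentence_def)
  then show ?thesis using assms(1,4) ex unfolding mso_equiv_def by blast
qed

lemma mso_equiv_sym: "mso_equiv \<xi> \<eta> \<Longrightarrow> mso_equiv \<eta> \<xi>"
  by (simp add: mso_equiv_def)

lemma mso_equiv_language:
  assumes "mso_equiv \<xi> \<eta>"
  shows "language \<xi> = language \<eta>"
proof -
  have "language \<xi> \<subseteq> language \<eta>" if eq: "mso_equiv \<xi> \<eta>" for \<xi> \<eta>
  proof
    fix t assume "t \<in> language \<xi>"
    then obtain p where "segment \<xi> p (length t) = t" using in_languageD by blast
    then obtain q where "segment \<eta> q (length t) = t"
      using mso_equiv_transfer[OF eq free1_word_fm free2_fm(4), of p t] by (auto simp: sat_word_fm)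
    then show "t \<in> language \<eta>" using segment_in_language by metis
  qed
  then show ?thesis using assms mso_equiv_sym by blast
qed

text \<open>The letter at each offset from a definable position is expressible, and uniqueness in
  \<open>\<eta>\<close> ties the witnesses for all offsets together.\<close>

lemma mso_equiv_definable_position:
  assumes eq: "mso_equiv \<xi> \<eta>" and free: "free1 \<delta> \<subseteq> {0}" "free2 \<delta> = {}"
    and p: "sat (\<xi> -` {True}) (\<lambda>_. p) (\<lambda>_. {}) \<delta>"
    and uniq: "\<And>q q'. sat (\<eta> -` {True}) (\<lambda>_. q) (\<lambda>_. {}) \<delta> \<Longrightarrow>
      sat (\<eta> -` {True}) (\<lambda>_. q') (\<lambda>_. {}) \<delta> \<Longrightarrow> q = q'"
  shows "\<exists>c. \<eta> = (\<lambda>n. \<xi> (n + c))"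
proof -
  obtain q where q: "sat (\<eta> -` {True}) (\<lambda>_. q) (\<lambda>_. {}) \<delta>"
    using mso_equiv_transfer[OF eq free p] by blast
  have cong: "sat P (v(Suc 0 := a)) V \<delta> \<longleftrightarrow> sat P v V \<delta>" for P :: "int set" and v V a
    by (rule sat_cong) (use free in auto)
  have "\<eta> (q + n) = \<xi> (p + n)" for n
  proof -
    \<comment> \<open>\<open>plus_fm\<close> adds naturals only; for a negative offset the two
      variables exchange roles.\<close>
    define pos where "pos = (if n \<ge> 0 then plus_fm (nat n) 0 1 else plus_fm (nat (- n)) 1 0)"
    have pos: "sat P v V pos \<longleftrightarrow> v 1 = v 0 + n" for P V and v :: "nat \<Rightarrow> int"
      by (auto simp: pos_def sat_plus_fm)
    \<comment> \<open>Each offset is transferred by its own sentence and brings its own witness;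
      repeating \<open>\<delta>\<close> in it forces the witness to be \<open>q\<close>.\<close>
    define \<phi> where "\<phi> = Conj \<delta> (Ex1 1 (Conj pos (letter_fm (\<xi> (p + n)) 1)))"
    have "free1 pos \<subseteq> {0, 1}" "free2 pos = {}"
      using free1_plus_fm[of _ 0 1] free1_plus_fm[of _ 1 0] by (auto simp: pos_def free2_fm)
    then have "free1 \<phi> \<subseteq> {0}" "free2 \<phi> = {}"
      using free by (auto simp: \<phi>_def free1_fm free2_fm)
    moreover have "sat (\<xi> -` {True}) (\<lambda>_. p) (\<lambda>_. {}) \<phi>"
      using p by (simp add: \<phi>_def pos sat_letter_fm)
    ultimately obtain q' where "sat (\<eta> -` {True}) (\<lambda>_. q') (\<lambda>_. {}) \<phi>"
      using mso_equiv_transfer[OF eq] by blast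
    then have "sat (\<eta> -` {True}) (\<lambda>_. q') (\<lambda>_. {}) \<delta>" "\<eta> (q' + n) = \<xi> (p + n)"
      by (auto simp: \<phi>_def pos sat_letter_fm)
    then show ?thesis using uniq[OF q] by simp
  qed
  from this[of "m - q" for m] have "\<eta> m = \<xi> (m + (p - q))" for m
    by (simp add: algebra_simps)
  then show ?thesis by blast
qed

section \<open>Shifts\<close>

lemma mso_equiv_shift: "mso_equiv \<xi> (\<lambda>n. \<xi> (n + c))"
proof (rule mso_equiv_of_word_game)
  have "surj (\<lambda>n. n + - c)" by (rule surjI[of _ "\<lambda>n. n + c"]) simp
  then show "word_game m k UNIV \<xi> UNIV (\<lambda>n. \<xi> (n + c))" for m k
    by (intro word_game_shift[of _ "- c"]) auto
qed

lemma mso_type_eq_shifts: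
  assumes "\<And>\<eta>. mso_equiv \<xi> \<eta> \<Longrightarrow> \<exists>c. \<eta> = (\<lambda>n. \<xi> (n + c))"
  shows "mso_type \<xi> = range (\<lambda>c n. \<xi> (n + c))"
  unfolding mso_type_def using assms mso_equiv_shift by blast

lemma is_period_of_shifts_eq:
  assumes "(\<lambda>n. \<xi> (n + c)) = (\<lambda>n. \<xi> (n + d))" and "c < d"
  shows "is_period \<xi> (nat (d - c))"
proof -
  have "\<xi> n = \<xi> (n + (d - c))" for n
    using fun_cong[OF assms(1), of "n - c"] by (simp add: algebra_simps)
  then show ?thesis using assms(2) by (simp add: is_period_def)
qed

lemma is_period_mult:
  assumes "is_period \<xi> p"
  shows "\<xi> (n + int p * k) = \<xi> n"
proof -
  have nat: "\<xi> (n + int p * int k) = \<xi> n" for n k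
  proof (induction k)
    case (Suc k)
    have "\<xi> (n + int p * int (Suc k)) = \<xi> (n + int p * int k + int p)"
      by (simp add: algebra_simps)
    also have "\<dots> = \<xi> (n + int p * int k)" using assms by (simp add: is_period_def)
    finally show ?case using Suc by simp
  qed simp
  show ?thesis
  proof (cases "k \<ge> 0")
    case True
    then show ?thesis using nat[of n "nat k"] by simp
  next
    case False
    then show ?thesis using nat[of "n + int p * k" "nat (- k)"] by simp
  qed
qed

section \<open>Periodic words\<close>

lemma periodic_imp_recurrent:
  assumes "periodic \<xi>"
  shows "recurrent \<xi>"
  unfolding recurrent_iff
proof (intro ballI allI)
  fix t i assume "t \<in> language \<xi>"
  then obtain q where q: "segment \<xi> q (length t) = t" using in_languageD by blast
  obtain p where p: "is_period \<xi> p" using assms by (auto simp: periodic_def)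
  have "\<xi> (q + int p * k + j) = \<xi> (q + j)" for k j
    using is_period_mult[OF p, of "q + j" k] by (simp add: algebra_simps)
  then have shift: "segment \<xi> (q + int p * k) (length t) = t" for k
    using q segment_eq_iff[of \<xi> "q + int p * k" "length t" \<xi> q] by simp
  have "\<bar>i - q\<bar> \<le> int p * \<bar>i - q\<bar>"
    using p mult_right_mono[of 1 "int p" "\<bar>i - q\<bar>"] by (simp add: is_period_def)
  then have "i \<le> q + int p * \<bar>i - q\<bar>" "q + int p * (- \<bar>i - q\<bar>) \<le> i" by simp_all
  then show "(\<exists>q\<ge>i. segment \<xi> q (length t) = t) \<and> (\<exists>q\<le>i. segment \<xi> q (length t) = t)"
    using shift by blast
qed

text \<open>Factors of length \<open>Suc p\<close> carry the period over to \<open>\<eta>\<close>;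
  one factor of length \<open>p\<close>, located in \<open>\<xi>\<close>, then fixes the
  shift.\<close>

lemma periodic_mso_equiv_shift:
  assumes p: "is_period \<xi> p" and "mso_equiv \<xi> \<eta>"
  shows "\<exists>c. \<eta> = (\<lambda>n. \<xi> (n + c))"
proof -
  have lang: "\<exists>m. segment \<eta> n l = segment \<xi> m l" for n l
    using segment_in_language[of \<eta> n l] mso_equiv_language[OF assms(2)] in_languageD[of _ \<xi>]
    by (metis length_segment)
  have "\<eta> n = \<eta> (n + int p)" for n
  proof -
    obtain m where m: "segment \<eta> n (Suc p) = segment \<xi> m (Suc p)" using lang by blast
    then have "\<eta> (n + int 0) = \<xi> (m + int 0)" "\<eta> (n + int p) = \<xi> (m + int p)"
      unfolding segment_eq_iff by blast+
    then show ?thesis using p by (simp add: is_period_def)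
  qed
  then have p': "is_period \<eta> p" using p by (simp add: is_period_def)
  obtain m where m: "segment \<eta> 0 p = segment \<xi> m p" using lang by blast
  have "\<eta> n = \<xi> (n + m)" for n
  proof -
    have pos: "int p > 0" using p by (simp add: is_period_def)
    then have "nat (n mod int p) < p" by (simp add: nat_less_iff)
    then have "\<eta> (n mod int p) = \<xi> (m + n mod int p)"
      using m pos unfolding segment_eq_iff by fastforce
    moreover have "n = n mod int p + int p * (n div int p)" by simp
    ultimately show ?thesis
      using is_period_mult[OF p', of "n mod int p" "n div int p"]
        is_period_mult[OF p, of "m + n mod int p" "n div int p"] by (simp add: ac_simps)
  qed
  then show ?thesis by blast
qed

lemma card_mso_type_periodic:
  assumes "periodic \<xi>"
  shows "finite (mso_type \<xi>) \<and> card (mso_type \<xi>) = period \<xi>"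
proof -
  let ?p = "period \<xi>"
  have p: "is_period \<xi> ?p"
    using assms unfolding periodic_def period_def by (rule LeastI_ex)
  have "(\<lambda>n. \<xi> (n + c)) \<in> (\<lambda>c n. \<xi> (n + c)) ` {0..<int ?p}" for c
  proof (rule image_eqI)
    show "c mod int ?p \<in> {0..<int ?p}" using p by (simp add: is_period_def)
    have "\<xi> (n + c) = \<xi> (n + c mod int ?p)" for n
      using is_period_mult[OF p, of "n + c mod int ?p" "c div int ?p"] by (simp add: add.assoc)
    then show "(\<lambda>n. \<xi> (n + c)) = (\<lambda>n. \<xi> (n + c mod int ?p))" by simp
  qed
  then have "range (\<lambda>c n. \<xi> (n + c)) = (\<lambda>c n. \<xi> (n + c)) ` {0..<int ?p}"
    by (intro equalityI image_subsetI image_mono) simp_all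
  then have type: "mso_type \<xi> = (\<lambda>c n. \<xi> (n + c)) ` {0..<int ?p}"
    using mso_type_eq_shifts[OF periodic_mso_equiv_shift[OF p]] by (rule trans[rotated])
  have "inj_on (\<lambda>c n. \<xi> (n + c)) {0..<int ?p}"
  proof (rule linorder_inj_onI')
    fix c d assume cd: "c \<in> {0..<int ?p}" "d \<in> {0..<int ?p}" "c < d"
    then have "nat (d - c) < ?p" by auto
    then have "\<not> is_period \<xi> (nat (d - c))"
      unfolding period_def by (rule not_less_Least)
    then show "(\<lambda>n. \<xi> (n + c)) \<noteq> (\<lambda>n. \<xi> (n + d))"
      using is_period_of_shifts_eq cd(3) by blast
  qed
  then show ?thesis unfolding type by (simp add: card_image)
qed

section \<open>Words that are not recurrent\<close>

lemma non_recurrent_mso_equiv_shift: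
  assumes "\<not> recurrent \<xi>" and eq: "mso_equiv \<xi> \<eta>"
  shows "\<exists>c. \<eta> = (\<lambda>n. \<xi> (n + c))"
proof -
  obtain t i where t: "t \<in> language \<xi>"
    and i: "(\<forall>q\<ge>i. segment \<xi> q (length t) \<noteq> t) \<or> (\<forall>q\<le>i. segment \<xi> q (length t) \<noteq> t)"
    using assms(1) unfolding recurrent_iff by blast
  obtain a where a: "segment \<xi> a (length t) = t" using t in_languageD by blast
  \<comment> \<open>The argument compares the position with all other occurrences of
    \<open>t\<close>: \<open>Le 0 1\<close> selects the first one, \<open>Le 1 0\<close> the last.
    Extremality yields uniqueness in every word.\<close>
  define ext where "ext le = Conj (word_fm t 0) (All1 1 (Disj (Neg (word_fm t 1)) le))" for le
  have free: "free1 (ext le) \<subseteq> {0}" "free2 (ext le) = {}" if "le \<in> {Le 0 1, Le 1 0}" for le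
    using free1_word_fm[of t 0] free1_word_fm[of t 1] that by (auto simp: ext_def free2_fm)
  have sat: "sat (\<zeta> -` {True}) (\<lambda>_. p) (\<lambda>_. {}) (ext (Le 0 1)) \<longleftrightarrow>
        segment \<zeta> p (length t) = t \<and> (\<forall>q. segment \<zeta> q (length t) = t \<longrightarrow> p \<le> q)"
      "sat (\<zeta> -` {True}) (\<lambda>_. p) (\<lambda>_. {}) (ext (Le 1 0)) \<longleftrightarrow>
        segment \<zeta> p (length t) = t \<and> (\<forall>q. segment \<zeta> q (length t) = t \<longrightarrow> q \<le> p)" for \<zeta> p
    by (auto simp: ext_def sat_word_fm)
  from i show ?thesis
  proof
    assume i: "\<forall>q\<ge>i. segment \<xi> q (length t) \<noteq> t"
    \<comment> \<open>Cutting off below at the known occurrence \<open>a\<close> makes the set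
      finite without losing the maximum.\<close>
    define S where "S = {q \<in> {a..i}. segment \<xi> q (length t) = t}"
    have fin: "finite S" unfolding S_def by (rule finite_subset[of _ "{a..i}"]) auto
    have bound: "q \<le> i" if "segment \<xi> q (length t) = t" for q using i that by (meson linear)
    have "a \<in> S" using a bound[OF a] by (simp add: S_def)
    have "Max S \<in> S" using Max_in fin \<open>a \<in> S\<close> by blast
    moreover have "q \<le> Max S" if "segment \<xi> q (length t) = t" for q
    proof (cases "q \<ge> a")
      case True
      have "q \<in> S" using True that bound[OF that] by (simp add: S_def)
      then show ?thesis using fin by (rule Max_ge[rotated])
    next
      case False
      then show ?thesis using Max_ge[OF fin \<open>a \<in> S\<close>] by simp
    qed
    ultimately have pos: "sat (\<xi> -` {True}) (\<lambda>_. Max S) (\<lambda>_. {}) (ext (Le 1 0))"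
      unfolding sat by (simp add: S_def)
    show ?thesis
    proof (rule mso_equiv_definable_position[OF eq free(1) free(2) pos])
      show "q = q'" if "sat (\<eta> -` {True}) (\<lambda>_. q) (\<lambda>_. {}) (ext (Le 1 0))"
          "sat (\<eta> -` {True}) (\<lambda>_. q') (\<lambda>_. {}) (ext (Le 1 0))" for q q'
        using that unfolding sat by (meson antisym)
    qed simp_all
  next
    assume i: "\<forall>q\<le>i. segment \<xi> q (length t) \<noteq> t"
    define S where "S = {q \<in> {i..a}. segment \<xi> q (length t) = t}"
    have fin: "finite S" unfolding S_def by (rule finite_subset[of _ "{i..a}"]) auto
    have bound: "i \<le> q" if "segment \<xi> q (length t) = t" for q using i that by (meson linear)
    have "a \<in> S" using a bound[OF a] by (simp add: S_def)
    have "Min S \<in> S" using Min_in fin \<open>a \<in> S\<close> by blast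
    moreover have "Min S \<le> q" if "segment \<xi> q (length t) = t" for q
    proof (cases "q \<le> a")
      case True
      have "q \<in> S" using True that bound[OF that] by (simp add: S_def)
      then show ?thesis using fin by (rule Min_le[rotated])
    next
      case False
      then show ?thesis using Min_le[OF fin \<open>a \<in> S\<close>] by simp
    qed
    ultimately have pos: "sat (\<xi> -` {True}) (\<lambda>_. Min S) (\<lambda>_. {}) (ext (Le 0 1))"
      unfolding sat by (simp add: S_def)
    show ?thesis
    proof (rule mso_equiv_definable_position[OF eq free(1) free(2) pos])
      show "q = q'" if "sat (\<eta> -` {True}) (\<lambda>_. q) (\<lambda>_. {}) (ext (Le 0 1))"
          "sat (\<eta> -` {True}) (\<lambda>_. q') (\<lambda>_. {}) (ext (Le 0 1))" for q q'
        using that unfolding sat by (meson antisym)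
    qed simp_all
  qed
qed

lemma mso_type_non_recurrent:
  assumes "\<not> recurrent \<xi>"
  shows "mso_type \<xi> \<approx> (UNIV :: nat set)"
proof -
  have "\<not> is_period \<xi> p" for p
    using assms periodic_imp_recurrent by (auto simp: periodic_def)
  then have "inj (\<lambda>c n. \<xi> (n + c))"
    using is_period_of_shifts_eq by (intro linorder_inj_onI') blast
  then have "range (\<lambda>c n. \<xi> (n + c)) \<approx> (UNIV :: int set)"
    by (rule inj_on_image_eqpoll_self)
  also have "(UNIV :: int set) \<approx> (UNIV :: nat set)"
    using bij_int_encode unfolding eqpoll_def by blast
  finally show ?thesis
    using mso_type_eq_shifts[OF non_recurrent_mso_equiv_shift[OF assms]] by simp
qed

section \<open>A Cantor scheme of recurrent words\<close>

definition agree :: "biword \<Rightarrow> nat \<Rightarrow> int \<Rightarrow> int \<Rightarrow> bool" where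
  "agree \<xi> n p q \<longleftrightarrow> (\<forall>j. \<bar>j\<bar> \<le> int n \<longrightarrow> \<xi> (p + j) = \<xi> (q + j))"

lemma recurrent_agree:
  assumes "recurrent \<xi>"
  shows "\<exists>q\<ge>i. agree \<xi> n p q" "\<exists>q\<le>i. agree \<xi> n p q"
proof -
  let ?t = "segment \<xi> (p - int n) (Suc (2 * n))"
  have ag: "agree \<xi> n p (s + int n)" if "segment \<xi> s (length ?t) = ?t" for s
    unfolding agree_def
  proof (intro allI impI)
    fix j :: int assume j: "\<bar>j\<bar> \<le> int n"
    then have "nat (j + int n) < Suc (2 * n)" by auto
    then have "\<xi> (s + int (nat (j + int n))) = \<xi> (p - int n + int (nat (j + int n)))"
      using that unfolding length_segment segment_eq_iff by blast
    moreover have "int (nat (j + int n)) = j + int n" using j by simp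
    ultimately show "\<xi> (p + j) = \<xi> (s + int n + j)" by (simp add: algebra_simps)
  qed
  have occ: "(\<exists>s\<ge>i. segment \<xi> s (length ?t) = ?t) \<and> (\<exists>s\<le>i. segment \<xi> s (length ?t) = ?t)" for i
    using assms segment_in_language unfolding recurrent_iff by blast
  obtain s where "s \<ge> i" "segment \<xi> s (length ?t) = ?t" using occ by blast
  then show "\<exists>q\<ge>i. agree \<xi> n p q" using ag by (intro exI[of _ "s + int n"]) simp
  \<comment> \<open>The centre lies \<open>n\<close> to the right of the start of its window, hence
    the bound \<open>i - int n\<close>.\<close>
  obtain s where "s \<le> i - int n" "segment \<xi> s (length ?t) = ?t" using occ by blast
  then show "\<exists>q\<le>i. agree \<xi> n p q" using ag by (intro exI[of _ "s + int n"]) simp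
qed

text \<open>
  A pair \<open>(p, n)\<close> stands for the window of radius \<open>n\<close> around \<open>p\<close>, read as a word on \<open>{-n..n}\<close>.
  A refinement is a longer such word that moreover contains, on both sides of \<open>{-n..n}\<close>, a copy
  of the window of radius \<open>n\<close> around 0; this makes the limit words recurrent.
\<close>

definition refines :: "biword \<Rightarrow> int \<times> nat \<Rightarrow> int \<times> nat \<Rightarrow> bool" where
  "refines \<xi> = (\<lambda>(p, n) (q, n'). n < n' \<and> agree \<xi> n p q \<and>
     (\<exists>c. 2 * int n \<le> c \<and> c + int n \<le> int n' \<and> agree \<xi> n 0 (q + c)) \<and>
     (\<exists>c. c \<le> - 2 * int n \<and> - int n' \<le> c - int n \<and> agree \<xi> n 0 (q + c)))"

lemma agree_refines:
  assumes "recurrent \<xi>" and "agree \<xi> n p q"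
  shows "\<exists>N. \<forall>n'\<ge>N. refines \<xi> (p, n) (q, n')"
proof -
  obtain r s where r: "r \<ge> q + 2 * int n" "agree \<xi> n 0 r" and s: "s \<le> q - 2 * int n" "agree \<xi> n 0 s"
    using recurrent_agree[OF assms(1)] by meson
  \<comment> \<open>The three summands make the radius exceed \<open>n\<close>, reach the end of the
    right copy around \<open>r\<close>, and reach the end of the left copy around
    \<open>s\<close>.\<close>
  have "refines \<xi> (p, n) (q, n')" if "n' \<ge> Suc n + nat (r - q + int n) + nat (q - s + int n)" for n'
    unfolding refines_def prod.case
  proof (intro conjI)
    show "\<exists>c. 2 * int n \<le> c \<and> c + int n \<le> int n' \<and> agree \<xi> n 0 (q + c)"
      using r that by (intro exI[of _ "r - q"]) auto
    show "\<exists>c. c \<le> - 2 * int n \<and> - int n' \<le> c - int n \<and> agree \<xi> n 0 (q + c)"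
      using s that by (intro exI[of _ "s - q"]) auto
  qed (use that assms in auto)
  then show ?thesis by blast
qed

text \<open>A later position \<open>q\<close> with the same window must differ from \<open>p\<close>
  somewhere, or \<open>q - p\<close> would be a period. Radii large enough to show the difference
  make the two refinements incompatible.\<close>

lemma ex_incompatible_refinements:
  assumes "recurrent \<xi>" and "\<not> periodic \<xi>"
  shows "\<exists>y z. refines \<xi> x y \<and> refines \<xi> x z \<and>
    (\<exists>j. \<bar>j\<bar> \<le> int (snd y) \<and> \<bar>j\<bar> \<le> int (snd z) \<and> \<xi> (fst y + j) \<noteq> \<xi> (fst z + j))"
proof -
  obtain p n where x: "x = (p, n)" by (cases x)
  obtain q where q: "q \<ge> p + 1" "agree \<xi> n p q" using recurrent_agree[OF assms(1)] by blast
  have "\<exists>j. \<xi> (p + j) \<noteq> \<xi> (q + j)"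
  proof (rule ccontr)
    assume "\<not> ?thesis"
    then have "(\<lambda>m. \<xi> (m + p)) = (\<lambda>m. \<xi> (m + q))" by (simp add: add.commute)
    then show False
      using is_period_of_shifts_eq[of \<xi> p q] q(1) assms(2) by (auto simp: periodic_def)
  qed
  then obtain j where j: "\<xi> (p + j) \<noteq> \<xi> (q + j)" by blast
  obtain N where N: "\<And>n'. n' \<ge> N \<Longrightarrow> refines \<xi> x (p, n')"
    using agree_refines[OF assms(1), of n p p] unfolding x by (auto simp: agree_def)
  obtain N' where N': "\<And>n'. n' \<ge> N' \<Longrightarrow> refines \<xi> x (q, n')"
    using agree_refines[OF assms(1) q(2)] unfolding x by blast
  define M where "M = N + N' + nat \<bar>j\<bar>"
  have "refines \<xi> x (p, M)" "refines \<xi> x (q, M)" by (auto intro: N N' simp: M_def)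
  moreover have "\<bar>j\<bar> \<le> int M" by (simp add: M_def)
  ultimately show ?thesis using j by (intro exI[of _ "(p, M)"] exI[of _ "(q, M)"]) auto
qed

locale refining_sequence =
  fixes \<xi> :: biword and node :: "nat \<Rightarrow> int \<times> nat"
  assumes refines: "refines \<xi> (node k) (node (Suc k))"
begin

definition center :: "nat \<Rightarrow> int" where "center k = fst (node k)"
definition radius :: "nat \<Rightarrow> nat" where "radius k = snd (node k)"

text \<open>The windows are nested, so every \<open>k\<close> whose radius reaches
  \<open>\<bar>j\<bar>\<close> gives the same letter; \<open>nat \<bar>j\<bar>\<close> is such a
  \<open>k\<close> because the radii strictly increase.\<close>

definition limit_word :: biword where
  "limit_word j = \<xi> (center (nat \<bar>j\<bar>) + j)"

lemma refinement_step:
  "radius k < radius (Suc k)" "agree \<xi> (radius k) (center k) (center (Suc k))"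
  "\<exists>c. 2 * int (radius k) \<le> c \<and> c + int (radius k) \<le> int (radius (Suc k)) \<and>
     agree \<xi> (radius k) 0 (center (Suc k) + c)"
  "\<exists>c. c \<le> - 2 * int (radius k) \<and> - int (radius (Suc k)) \<le> c - int (radius k) \<and>
     agree \<xi> (radius k) 0 (center (Suc k) + c)"
  using refines[of k] unfolding refines_def center_def radius_def by (auto simp: case_prod_beta)

lemma le_radius: "k \<le> radius k"
proof (induction k)
  case (Suc k)
  then show ?case using refinement_step(1)[of k] by simp
qed simp

lemma agree_center:
  assumes "k \<le> l"
  shows "agree \<xi> (radius k) (center k) (center l)"
  using assms
proof (induction l rule: dec_induct)
  case (step l)
  have "radius k \<le> radius l"
    using less_imp_le[OF refinement_step(1)] step(1) by (rule lift_Suc_mono_le)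
  with step(3) refinement_step(2)[of l] show ?case by (auto simp: agree_def)
qed (simp add: agree_def)

lemma limit_word_eq:
  assumes "\<bar>j\<bar> \<le> int (radius k)"
  shows "limit_word j = \<xi> (center k + j)"
proof -
  define l where "l = max k (nat \<bar>j\<bar>)"
  have "\<bar>j\<bar> \<le> int (radius (nat \<bar>j\<bar>))" using le_radius[of "nat \<bar>j\<bar>"] by simp
  then have "limit_word j = \<xi> (center l + j)"
    using agree_center[of "nat \<bar>j\<bar>" l] by (simp add: agree_def limit_word_def l_def)
  moreover have "\<xi> (center k + j) = \<xi> (center l + j)"
    using agree_center[of k l] assms by (simp add: agree_def l_def)
  ultimately show ?thesis by simp
qed

lemma limit_word_copy:
  assumes "t \<in> language \<xi>"
  shows "\<exists>q\<ge>i. segment limit_word q (length t) = t" "\<exists>q\<le>i. segment limit_word q (length t) = t"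
proof -
  obtain p where p: "segment \<xi> p (length t) = t" using assms in_languageD by blast
  \<comment> \<open>At this level the window around 0 contains the occurrence of \<open>t\<close> at
    \<open>p\<close>; its two copies are centred at least twice the radius away, which puts the
    copied occurrences beyond \<open>i\<close> on either side.\<close>
  define k where "k = nat \<bar>p\<bar> + length t + nat \<bar>i\<bar>"
  let ?n = "int (radius k)"
  have "int k = \<bar>p\<bar> + int (length t) + \<bar>i\<bar>" by (simp add: k_def)
  moreover have "int k \<le> ?n" using le_radius[of k] by simp
  ultimately have k: "\<bar>p\<bar> + int (length t) + \<bar>i\<bar> \<le> ?n" by simp
  have copy: "segment limit_word (c + p) (length t) = t"
    if c: "\<bar>c\<bar> + ?n \<le> int (radius (Suc k))" "agree \<xi> (radius k) 0 (center (Suc k) + c)" for c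
  proof -
    have "limit_word (c + p + int l) = \<xi> (p + int l)" if "l < length t" for l
    proof -
      have "\<bar>p + int l\<bar> \<le> ?n" using k that by simp
      moreover from this have "\<bar>c + (p + int l)\<bar> \<le> int (radius (Suc k))" using c(1) by simp
      ultimately show ?thesis
        using limit_word_eq[of "c + (p + int l)" "Suc k"] c(2) by (simp add: agree_def add.assoc)
    qed
    then show ?thesis using p segment_eq_iff[of limit_word "c + p" "length t" \<xi> p] by simp
  qed
  obtain c where c: "2 * ?n \<le> c" "c + ?n \<le> int (radius (Suc k))"
      "agree \<xi> (radius k) 0 (center (Suc k) + c)"
    using refinement_step(3)[of k] by blast
  then have "segment limit_word (c + p) (length t) = t" by (intro copy) auto
  moreover have "i \<le> c + p" using c(1) k by simp
  ultimately show "\<exists>q\<ge>i. segment limit_word q (length t) = t" by blast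
  obtain d where d: "d \<le> - 2 * ?n" "- int (radius (Suc k)) \<le> d - ?n"
      "agree \<xi> (radius k) 0 (center (Suc k) + d)"
    using refinement_step(4)[of k] by blast
  then have "segment limit_word (d + p) (length t) = t" by (intro copy) auto
  moreover have "d + p \<le> i" using d(1) k by simp
  ultimately show "\<exists>q\<le>i. segment limit_word q (length t) = t" by blast
qed

lemma language_limit_word: "language limit_word = language \<xi>"
proof
  show "language limit_word \<subseteq> language \<xi>"
  proof
    fix t assume "t \<in> language limit_word"
    then obtain p n where t: "t = segment limit_word p n" by (auto simp: language_def)
    define k where "k = nat \<bar>p\<bar> + n"
    have "int k = \<bar>p\<bar> + int n" by (simp add: k_def)
    moreover have "int k \<le> int (radius k)" using le_radius[of k] by simp
    ultimately have "\<bar>p + int l\<bar> \<le> int (radius k)" if "l < n" for l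
      using that by simp
    then have "t = segment \<xi> (center k + p) n"
      unfolding t segment_eq_iff by (simp add: limit_word_eq add.assoc)
    then show "t \<in> language \<xi>" by (simp add: segment_in_language)
  qed
  show "language \<xi> \<subseteq> language limit_word"
    using limit_word_copy(1) segment_in_language by (metis subsetI)
qed

lemma recurrent_limit_word: "recurrent limit_word"
  unfolding recurrent_iff language_limit_word using limit_word_copy by blast

end

lemma mso_type_recurrent_aperiodic:
  assumes rec: "recurrent \<xi>" and "\<not> periodic \<xi>"
  shows "mso_type \<xi> \<approx> (UNIV :: nat set set)"
proof (rule lepoll_antisym)
  \<comment> \<open>The upper bound is crude: there are only continuum many bi-infinite
    words.\<close>
  have "inj (\<lambda>\<eta> :: biword. {n. \<eta> (int_decode n)})"
  proof (rule injI)
    fix \<eta> \<zeta> :: biword assume "{n. \<eta> (int_decode n)} = {n. \<zeta> (int_decode n)}"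
    then have decode: "\<eta> (int_decode n) = \<zeta> (int_decode n)" for n by blast
    show "\<eta> = \<zeta>"
    proof
      show "\<eta> n = \<zeta> n" for n using decode[of "int_encode n"] by simp
    qed
  qed
  then show "mso_type \<xi> \<lesssim> (UNIV :: nat set set)"
    unfolding lepoll_def using inj_on_subset by blast
next
  obtain f g where f: "\<And>x. refines \<xi> x (f x)" and g: "\<And>x. refines \<xi> x (g x)"
    and fg: "\<And>x. \<exists>j. \<bar>j\<bar> \<le> int (snd (f x)) \<and> \<bar>j\<bar> \<le> int (snd (g x)) \<and>
      \<xi> (fst (f x) + j) \<noteq> \<xi> (fst (g x) + j)"
    using ex_incompatible_refinements[OF assms] by metis
  \<comment> \<open>A set \<open>A\<close> is a branch of the binary tree: level \<open>k\<close>
    takes the child \<open>f\<close> or \<open>g\<close> according to whether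
    \<open>k \<in> A\<close>. The root \<open>(0, 0)\<close> is an arbitrary window.\<close>
  define node where "node A = rec_nat (0, 0) (\<lambda>k x. if k \<in> A then f x else g x)" for A :: "nat set"
  have node_Suc: "node A (Suc k) = (if k \<in> A then f (node A k) else g (node A k))" for A k
    by (simp add: node_def)
  interpret refining_sequence \<xi> "node A" for A
    by unfold_locales (simp add: node_Suc f g)
  have "mso_equiv \<xi> (limit_word A)" for A
    using rec recurrent_limit_word language_limit_word by (rule recurrent_same_language_mso_equiv)
  moreover have "inj limit_word"
  proof (rule injI)
    fix A B assume eq: "limit_word A = limit_word B"
    show "A = B"
    proof (rule ccontr)
      assume "A \<noteq> B"
      then have "\<exists>k. \<not> (k \<in> A \<longleftrightarrow> k \<in> B)" by blast
      \<comment> \<open>At the least level where the sets differ, both branches stand at the same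
        node and split into the incompatible windows of \<open>f\<close> and \<open>g\<close>; the
        limits keep the difference.\<close>
      then obtain k where k: "\<not> (k \<in> A \<longleftrightarrow> k \<in> B)" "\<And>l. l < k \<Longrightarrow> l \<in> A \<longleftrightarrow> l \<in> B"
        using exists_least_iff[of "\<lambda>k. \<not> (k \<in> A \<longleftrightarrow> k \<in> B)"] by blast
      have "node A l = node B l" if "l \<le> k" for l
        using that by (induction l) (simp_all add: node_Suc k(2), simp add: node_def)
      then have "node A k = node B k" by simp
      moreover obtain j where "\<bar>j\<bar> \<le> int (snd (f (node A k)))" "\<bar>j\<bar> \<le> int (snd (g (node A k)))"
          "\<xi> (fst (f (node A k)) + j) \<noteq> \<xi> (fst (g (node A k)) + j)"
        using fg by blast
      ultimately have "limit_word A j \<noteq> limit_word B j"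
        using k(1) limit_word_eq[of j A "Suc k"] limit_word_eq[of j B "Suc k"]
        by (auto simp: radius_def center_def node_Suc)
      then show False using eq by simp
    qed
  qed
  ultimately show "(UNIV :: nat set set) \<lesssim> mso_type \<xi>"
    unfolding lepoll_def mso_type_def by blast
qed

theorem theorem6p2:
  fixes \<xi> :: biword
  shows "(periodic \<xi> \<longrightarrow> finite (mso_type \<xi>) \<and> card (mso_type \<xi>) = period \<xi>) \<and>
         (\<not> recurrent \<xi> \<longrightarrow> mso_type \<xi> \<approx> (UNIV :: nat set)) \<and>
         (recurrent \<xi> \<and> \<not> periodic \<xi> \<longrightarrow> mso_type \<xi> \<approx> (UNIV :: nat set set))"
  using card_mso_type_periodic mso_type_non_recurrent mso_type_recurrent_aperiodic by blast

end
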